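(* Let $\mu,\nu$ be two positive measures on $\mathbb{D}$, let $r_0>0$, and let $\omega$ be a weight on $\mathbb{D}$. If the weighted sub-mean property (with constant $C_{\mathrm{ws}}$) and the local doubling property hold for $\mu$ at the fixed scale $r_0$, and $$\nu(Q)\le C\,\mu(Q)\qquad\text{for every dyadic box }Q,$$ then for every $f\in A^p_\omega$ and $0<p<\infty$, there exists a constant $K=K(r_0,C,C_{\mathrm{ws}})$ such that $$\int_{\mathbb{D}}|f|^p\,d\nu\le K\int_{\mathbb{D}}|f|^p\,d\mu.$$
   Context: $\mathbb{D}$ is the open unit disk in $\mathbb{C}$, $dA=\frac1\pi r\,dr\,d\theta$ is normalized area measure, and $B_{\rho_h}(z,r)$ is the ball of center $z$ and radius $r$ for the hyperbolic distance $\rho_h$ on $\mathbb{D}$. A weight $\omega$ is a positive measurable function on $\mathbb{D}$. For $0<p<\infty$, $A^p_\omega$ is the space of analytic functions $f$ on $\mathbb{D}$ with $\int_{\mathbb{D}}|f|^p\,\omega\,dA<\infty$. Weighted sub-mean property at scale $r_0$: there exists $C_{\mathrm{ws}}$ such that for every locally integrable subharmonic function $g\ge0$, $$g(w)\le\frac{C_{\mathrm{ws}}}{\mu(B_{\rho_h}(w,r_0))}\int_{B_{\rho_h}(w,r_0)}g\,d\mu,\qquad w\in\mathbb{D}.$$ Local doubling at scale $r_0$: for each $\kappa\ge1$ there exists $D_\kappa\ge1$ such that $\mu(B_{\rho_h}(z,\kappa r_0))\le D_\kappa\,\mu(B_{\rho_h}(z,r_0))$ for all $z\in\mathbb{D}$.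 Dyadic boxes: identify $\partial\mathbb{D}$ with the torus $\mathbb{T}\cong[0,1)$. For $j\ge0$ and $0\le m<2^j$, let $I_{j,m}=[m/2^j,(m+1)/2^j)$, of length $|I_{j,m}|=2^{-j}$. The dyadic boxes are the sets $$Q_{j,m}=\{z\in\mathbb{D}:\ z/|z|\in I_{j,m},\ 1-|I_{j,m}|\le|z|<1-|I_{j,m}|/2\};$$ they are pairwise disjoint and form a partition of $\{z\in\mathbb{D}:0<|z|<1\}$.
   Formalization: The origin, which lies in no dyadic box as stated, is added to the box Q_{0,0} (so Q_{0,0} is the disk |z|<1/2); otherwise μ=dA, ν=Mδ_0, f=1 would contradict the claim for large M. *)

theory Defs
  imports "HOL-Complex_Analysis.Complex_Analysis"
begin

abbreviation unit_disk :: "complex set" (\<open>\<bbbD>\<close>) where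
  "\<bbbD> \<equiv> ball 0 1"

definition disk_area :: "complex measure" where
  "disk_area = scale_measure (ennreal (1 / pi)) (lebesgue_on \<bbbD>)"

(* Positive measures may take the value \<infinity>; no local finiteness is built in. *)
definition borel_measure_on_disk :: "complex measure \<Rightarrow> bool" where
  "borel_measure_on_disk \<mu> \<longleftrightarrow> sets \<mu> = sets (restrict_space borel \<bbbD>)"

definition disk_weight :: "(complex \<Rightarrow> real) \<Rightarrow> bool" where
  "disk_weight \<omega> \<longleftrightarrow> \<omega> \<in> borel_measurable disk_area \<and> (\<forall>z\<in>\<bbbD>. 0 < \<omega> z)"

definition weighted_bergman_space :: "real \<Rightarrow> (complex \<Rightarrow> real) \<Rightarrow> (complex \<Rightarrow> complex) set" where
  "weighted_bergman_space p \<omega> =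
     {f. f holomorphic_on \<bbbD> \<and> (\<integral>\<^sup>+z. ennreal (cmod (f z) powr p * \<omega> z) \<partial>disk_area) < \<infinity>}"

(* The distance of curvature -1, log ((1 + \<delta>) / (1 - \<delta>)) for the pseudohyperbolic distance \<delta>.
   Other normalizations multiply it by a constant, i.e. rescale radii. *)
definition hyperbolic_dist :: "complex \<Rightarrow> complex \<Rightarrow> real" where
  "hyperbolic_dist z w = 2 * artanh (cmod ((z - w) / (1 - cnj w * z)))"

definition hyperbolic_ball :: "complex \<Rightarrow> real \<Rightarrow> complex set" where
  "hyperbolic_ball z r = {w \<in> \<bbbD>. hyperbolic_dist z w < r}"

(* Real-valued subharmonic functions suffice here, since only nonnegative ones are used.
   For an upper semicontinuous function not attaining -\<infinity>, integrability over the circles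
   is implied by the sub-mean inequality; it is stated because the Bochner integral of a
   non-integrable function is 0. *)
definition subharmonic_on :: "(complex \<Rightarrow> real) \<Rightarrow> complex set \<Rightarrow> bool" where
  "subharmonic_on u S \<longleftrightarrow>
     open S \<and>
     (\<forall>z\<in>S. \<forall>c. u z < c \<longrightarrow> (\<forall>\<^sub>F w in at z. u w < c)) \<and>
     (\<forall>z\<in>S. \<exists>R>0. \<forall>r. 0 < r \<and> r < R \<longrightarrow>
        set_integrable lborel {0..2 * pi} (\<lambda>\<theta>. u (z + of_real r * cis \<theta>)) \<and>
        u z \<le> 1 / (2 * pi) * (LBINT \<theta>:{0..2 * pi}. u (z + of_real r * cis \<theta>)))"

definition locally_integrable_on_disk :: "complex measure \<Rightarrow> (complex \<Rightarrow> real) \<Rightarrow> bool" where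
  "locally_integrable_on_disk \<mu> g \<longleftrightarrow> (\<forall>K. compact K \<and> K \<subseteq> \<bbbD> \<longrightarrow> set_integrable \<mu> K g)"

(* For ennreal, a / \<infinity> = 0, a / 0 = \<infinity> for 0 < a, and \<infinity> * 0 = 0. So whenever some ball
   B(w, r0) has measure 0 or \<infinity>, the inequality at w forces g w = 0; if \<mu> is locally finite,
   g = 1 is admissible and hence all these balls have positive measure. *)
definition weighted_submean :: "complex measure \<Rightarrow> real \<Rightarrow> real \<Rightarrow> bool" where
  "weighted_submean \<mu> r0 Cws \<longleftrightarrow>
     (\<forall>g. subharmonic_on g \<bbbD> \<and> (\<forall>z\<in>\<bbbD>. 0 \<le> g z) \<and> locally_integrable_on_disk \<mu> g \<longrightarrow>
        (\<forall>w\<in>\<bbbD>. ennreal (g w) \<le>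
           ennreal Cws / emeasure \<mu> (hyperbolic_ball w r0) *
           (\<integral>\<^sup>+z\<in>hyperbolic_ball w r0. ennreal (g z) \<partial>\<mu>)))"

definition locally_doubling :: "complex measure \<Rightarrow> real \<Rightarrow> bool" where
  "locally_doubling \<mu> r0 \<longleftrightarrow>
     (\<forall>\<kappa>\<ge>1. \<exists>D\<ge>1. \<forall>z\<in>\<bbbD>.
        emeasure \<mu> (hyperbolic_ball z (\<kappa> * r0)) \<le>
        ennreal D * emeasure \<mu> (hyperbolic_ball z r0))"

definition dyadic_interval :: "nat \<Rightarrow> nat \<Rightarrow> real set" where
  "dyadic_interval j m = {real m / 2 ^ j ..< real (m + 1) / 2 ^ j}"

(* Under t \<mapsto> exp (2 \<pi> i t), the condition z / |z| \<in> I is z = |z| * exp (2 \<pi> i t) for some t \<in> I.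
   In this form it also makes sense at z = 0, where it holds for every I; thus the origin
   lies in the box for j = 0, which is the disk |z| < 1/2, and in no other, and the boxes
   partition the whole disk. Were the origin left out of all boxes, an atom of \<nu> at 0
   would not be controlled by \<mu>. *)
definition dyadic_box :: "nat \<Rightarrow> nat \<Rightarrow> complex set" where
  "dyadic_box j m =
     {z \<in> \<bbbD>. (\<exists>t\<in>dyadic_interval j m. z = of_real (cmod z) * cis (2 * pi * t)) \<and>
              1 - 1 / 2 ^ j \<le> cmod z \<and> cmod z < 1 - (1 / 2 ^ j) / 2}"

end

theory Submission
  imports Defs
begin

text \<open>For subharmonic \<open>g = \<bar>f\<bar>\<^sup>p\<close>, the supremum of \<open>g\<close> over a box \<open>Q\<close> is controlled by the average of
  \<open>g\<close> over balls of radius \<open>r\<^sub>0\<close> centred in \<open>Q\<close>; multiplying by \<open>\<nu>(Q) \<le> C \<mu>(Q)\<close> and summing over \<open>Q\<close>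
  gives the claim, once the \<open>\<mu>\<close>-measures of nearby balls are known to be comparable with a constant
  that depends on \<open>r\<^sub>0\<close> and \<open>C\<^sub>w\<^sub>s\<close> only. The doubling constants may not be used for this. Instead,
  the sub-mean property is tested on a subharmonic function supported in a sector: the ball about
  \<open>a\<close> has a fixed proportion of its mass in the sector pointing towards a nearby point \<open>b\<close>, and
  that part lies in the ball about \<open>b\<close>. Doubling only enters qualitatively: if one ball has
  infinite measure, then all have, and the sub-mean property forces \<open>g = 0\<close> unless \<open>g\<close> is not
  locally integrable.\<close>

section \<open>Pseudohyperbolic geometry\<close>

text \<open>The disk automorphism that moves \<open>a\<close> to the origin, with inverse
  \<open>disk_shift (- a)\<close>. Its modulus is the pseudohyperbolic distance, of which the
  hyperbolic distance is a monotone function.\<close>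

definition disk_shift :: "complex \<Rightarrow> complex \<Rightarrow> complex" where
  "disk_shift a z = (z - a) / (1 - cnj a * z)"

abbreviation pseudo_dist :: "complex \<Rightarrow> complex \<Rightarrow> real" where
  "pseudo_dist a z \<equiv> cmod (disk_shift a z)"

lemma one_minus_cnj_mult_nonzero:
  assumes "a \<in> \<bbbD>" "z \<in> \<bbbD>"
  shows "1 - cnj a * z \<noteq> 0"
proof
  assume "1 - cnj a * z = 0"
  then have "cmod (cnj a * z) = 1"
    by (metis norm_one right_minus_eq)
  moreover have "cmod a * cmod z < 1 * 1"
    using assms by (intro mult_strict_mono') auto
  ultimately show False
    by (simp add: norm_mult)
qed

lemma pseudo_dist_commute: "pseudo_dist a z = pseudo_dist z a"
proof -
  have "cmod (1 - cnj a * z) = cmod (cnj (1 - cnj a * z))"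
    by (rule complex_mod_cnj [symmetric])
  then show ?thesis
    by (simp add: disk_shift_def norm_divide norm_minus_commute mult.commute)
qed

lemma disk_shift_0 [simp]: "disk_shift 0 z = z" "disk_shift a a = 0" "disk_shift a 0 = - a"
  by (auto simp: disk_shift_def)

text \<open>Rests on the difference of squares of denominator and numerator, which factors. Both the
  triangle estimate and the bound on the size of a box are read off from this quotient.\<close>

lemma one_minus_pseudo_dist_sq:
  assumes "a \<in> \<bbbD>" "z \<in> \<bbbD>"
  shows "1 - (pseudo_dist a z)\<^sup>2 = (1 - (cmod a)\<^sup>2) * (1 - (cmod z)\<^sup>2) / (cmod (1 - cnj a * z))\<^sup>2"
proof -
  have "(cmod (1 - cnj a * z))\<^sup>2 - (cmod (z - a))\<^sup>2 = (1 - (cmod a)\<^sup>2) * (1 - (cmod z)\<^sup>2)"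
    unfolding cmod_power2 by (simp add: power2_eq_square algebra_simps)
  moreover have "cmod (1 - cnj a * z) \<noteq> 0"
    using one_minus_cnj_mult_nonzero[OF assms] by simp
  ultimately show ?thesis
    by (simp add: disk_shift_def norm_divide power_divide field_simps)
qed

lemma disk_shift_in_disk [simp]:
  assumes "a \<in> \<bbbD>" "z \<in> \<bbbD>"
  shows "disk_shift a z \<in> \<bbbD>"
proof -
  have "(1 - (cmod a)\<^sup>2) * (1 - (cmod z)\<^sup>2) > 0"
    using assms by (simp add: power_less_one_iff)
  then have "1 - (pseudo_dist a z)\<^sup>2 > 0"
    using one_minus_cnj_mult_nonzero[OF assms] by (simp add: one_minus_pseudo_dist_sq[OF assms])
  then show ?thesis
    by (simp add: power_less_one_iff)
qed

lemma disk_shift_inverse: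
  assumes "a \<in> \<bbbD>" "z \<in> \<bbbD>"
  shows "disk_shift (- a) (disk_shift a z) = z"
proof -
  have nz: "1 - cnj a * z \<noteq> 0" "1 - cnj a * a \<noteq> 0"
    using one_minus_cnj_mult_nonzero assms by blast+
  have "disk_shift a z + a = z * (1 - cnj a * a) / (1 - cnj a * z)"
    "1 + cnj a * disk_shift a z = (1 - cnj a * a) / (1 - cnj a * z)"
    using nz by (simp_all add: disk_shift_def field_simps)
  then show ?thesis
    using nz by (simp add: disk_shift_def)
qed

text \<open>The automorphism multiplies \<open>w - z\<close> and \<open>1 - cnj z * w\<close> by
  factors of equal modulus, which cancel. This invariance allows any chosen point to be moved to the
  origin.\<close>

lemma pseudo_dist_disk_shift:
  assumes "a \<in> \<bbbD>" "z \<in> \<bbbD>" "w \<in> \<bbbD>"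
  shows "pseudo_dist (disk_shift a z) (disk_shift a w) = pseudo_dist z w"
proof -
  have nz: "1 - cnj a * z \<noteq> 0" "1 - cnj a * w \<noteq> 0" "1 - a * cnj z \<noteq> 0" "1 - cnj a * a \<noteq> 0"
    "1 - cnj z * w \<noteq> 0"
    using one_minus_cnj_mult_nonzero assms by (metis mult.commute)+
  have 1: "disk_shift a w - disk_shift a z = (w - z) * (1 - cnj a * a) / ((1 - cnj a * z) * (1 - cnj a * w))"
    using nz by (simp add: disk_shift_def field_simps)
  have 2: "1 - cnj (disk_shift a z) * disk_shift a w =
      (1 - cnj a * a) * (1 - cnj z * w) / ((1 - a * cnj z) * (1 - cnj a * w))"
  proof -
    have "1 - cnj (disk_shift a z) * disk_shift a w =
        ((1 - a * cnj z) * (1 - cnj a * w) - (cnj z - cnj a) * (w - a)) / ((1 - a * cnj z) * (1 - cnj a * w))"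
      unfolding diff_divide_distrib using nz by (simp add: disk_shift_def)
    then show ?thesis
      by (simp add: algebra_simps)
  qed
  have "cmod (1 - a * cnj z) = cmod (1 - cnj a * z)"
    by (metis complex_cnj_cnj complex_cnj_diff complex_cnj_mult complex_cnj_one complex_mod_cnj)
  then show ?thesis
    unfolding disk_shift_def[of "disk_shift a z"] disk_shift_def[of z] 1 2 norm_divide norm_mult
    using nz by (simp add: field_simps)
qed

text \<open>A crude substitute for the sharp triangle inequality \<open>(s + t) / (1 + s * t)\<close>; all that
  matters is that it stays below 1.\<close>

definition triangle_bound :: "real \<Rightarrow> real \<Rightarrow> real" where
  "triangle_bound s t = sqrt (1 - (1 - s\<^sup>2) * (1 - t\<^sup>2) / 4)"

lemma triangle_bound:
  assumes "0 \<le> s" "s < 1" "0 \<le> t" "t < 1"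
  shows "0 \<le> triangle_bound s t" "triangle_bound s t < 1"
proof -
  have "0 < 1 - s\<^sup>2" "0 < 1 - t\<^sup>2"
    using assms by (simp_all add: power_less_one_iff)
  moreover have "(1 - s\<^sup>2) * (1 - t\<^sup>2) \<le> 1 * 1"
    using calculation by (intro mult_mono) auto
  ultimately show "0 \<le> triangle_bound s t" "triangle_bound s t < 1"
    by (simp_all add: triangle_bound_def)
qed

text \<open>Move the middle point \<open>b\<close> to the origin, so that \<open>s\<close> and
  \<open>t\<close> bound the moduli of the images of \<open>a\<close> and \<open>c\<close>. The 4 in
  \<open>triangle_bound\<close> comes from \<open>\<bar>1 - cnj u * v\<bar> \<le> 2\<close>.\<close>

lemma pseudo_dist_triangle:
  assumes "a \<in> \<bbbD>" "b \<in> \<bbbD>" "c \<in> \<bbbD>" "pseudo_dist a b \<le> s" "s < 1" "pseudo_dist b c \<le> t" "t < 1"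
  shows "pseudo_dist a c \<le> triangle_bound s t"
proof -
  define u v where "u = disk_shift b a" and "v = disk_shift b c"
  have uv: "u \<in> \<bbbD>" "v \<in> \<bbbD>"
    unfolding u_def v_def using assms(1-3) by (blast intro: disk_shift_in_disk)+
  have us: "cmod u \<le> s" "cmod v \<le> t"
    using assms by (simp_all add: u_def v_def pseudo_dist_commute)
  have "cmod (1 - cnj u * v) \<le> 1 + cmod u * cmod v"
    by (metis complex_mod_cnj norm_mult norm_one norm_triangle_ineq4)
  also have "\<dots> \<le> 1 + 1 * 1"
    using uv by (intro add_mono mult_mono) auto
  finally have "(cmod (1 - cnj u * v))\<^sup>2 \<le> 2\<^sup>2"
    by (intro power_mono) auto
  moreover have "1 - (cmod u)\<^sup>2 \<ge> 1 - s\<^sup>2" "1 - (cmod v)\<^sup>2 \<ge> 1 - t\<^sup>2"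
    using us by (simp_all add: power_mono)
  moreover have "0 \<le> 1 - s\<^sup>2" "0 \<le> 1 - t\<^sup>2"
    using assms(5,7) us norm_ge_zero[of u] norm_ge_zero[of v]
    by (simp_all add: power_le_one del: norm_ge_zero)
  ultimately have "(1 - s\<^sup>2) * (1 - t\<^sup>2) / 4 \<le> (1 - (cmod u)\<^sup>2) * (1 - (cmod v)\<^sup>2) / (cmod (1 - cnj u * v))\<^sup>2"
    using one_minus_cnj_mult_nonzero[OF uv] by (intro frac_le mult_mono) auto
  also have "\<dots> = 1 - (pseudo_dist a c)\<^sup>2"
    using one_minus_pseudo_dist_sq[OF uv] pseudo_dist_disk_shift assms by (simp add: u_def v_def)
  finally show ?thesis
    unfolding triangle_bound_def by (intro real_le_rsqrt) simp
qed

section \<open>Hyperbolic balls in pseudohyperbolic terms\<close>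

lemma artanh_less_iff:
  fixes x r :: real
  assumes "0 \<le> x" "x < 1"
  shows "artanh x < r \<longleftrightarrow> x < tanh r"
proof -
  have "tanh (artanh x) = x"
    using assms by (simp add: artanh_def tanh_real_altdef exp_minus field_simps)
  then show ?thesis
    by (metis tanh_real_less_iff)
qed

lemma hyperbolic_ball_eq:
  assumes "z \<in> \<bbbD>"
  shows "hyperbolic_ball z r = {w \<in> \<bbbD>. pseudo_dist z w < tanh (r / 2)}"
proof -
  have "hyperbolic_dist z w < r \<longleftrightarrow> pseudo_dist z w < tanh (r / 2)" if "w \<in> \<bbbD>" for w
  proof -
    have "hyperbolic_dist z w = 2 * artanh (pseudo_dist w z)"
      by (simp add: hyperbolic_dist_def disk_shift_def)
    then have "hyperbolic_dist z w < r \<longleftrightarrow> artanh (pseudo_dist w z) < r / 2"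
      by auto
    moreover have "artanh (pseudo_dist w z) < r / 2 \<longleftrightarrow> pseudo_dist w z < tanh (r / 2)"
      using disk_shift_in_disk[OF that assms] by (intro artanh_less_iff) auto
    ultimately show ?thesis
      by (simp add: pseudo_dist_commute)
  qed
  then show ?thesis
    by (auto simp: hyperbolic_ball_def)
qed

lemma holomorphic_disk_shift [holomorphic_intros]:
  assumes "a \<in> \<bbbD>"
  shows "disk_shift a holomorphic_on \<bbbD>"
  unfolding disk_shift_def using one_minus_cnj_mult_nonzero[OF assms]
  by (intro holomorphic_intros) auto

lemma continuous_on_disk_shift: "a \<in> \<bbbD> \<Longrightarrow> continuous_on \<bbbD> (disk_shift a)"
  by (intro holomorphic_on_imp_continuous_on holomorphic_disk_shift)

lemma open_pseudo_ball:
  assumes "a \<in> \<bbbD>"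
  shows "open {w \<in> \<bbbD>. pseudo_dist a w < s}"
proof -
  have "open (\<bbbD> \<inter> disk_shift a -` ball 0 s)"
    using continuous_on_disk_shift[OF assms] by (intro continuous_open_preimage) auto
  also have "\<bbbD> \<inter> disk_shift a -` ball 0 s = {w \<in> \<bbbD>. pseudo_dist a w < s}"
    by auto
  finally show ?thesis .
qed

text \<open>By compactness of the closed disk. Automorphisms carry this one cover to every other
  centre, so the number of balls does not depend on the centre.\<close>

lemma finite_pseudo_ball_cover:
  assumes "0 \<le> s" "s < 1" "0 < R"
  obtains F where "finite F" "F \<subseteq> \<bbbD>" "cball 0 s \<subseteq> (\<Union>a\<in>F. {w \<in> \<bbbD>. pseudo_dist a w < R})"
proof -
  have sub: "cball 0 s \<subseteq> \<bbbD>"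
    using assms by auto
  obtain F where "F \<subseteq> cball 0 s" "finite F" "cball 0 s \<subseteq> (\<Union>a\<in>F. {w \<in> \<bbbD>. pseudo_dist a w < R})"
  proof (rule compactE_image[of "cball 0 s" "cball 0 s" "\<lambda>a. {w \<in> \<bbbD>. pseudo_dist a w < R}"])
    show "open {w \<in> \<bbbD>. pseudo_dist a w < R}" if "a \<in> cball 0 s" for a
      using that sub by (intro open_pseudo_ball) blast
    show "cball 0 s \<subseteq> (\<Union>a\<in>cball 0 s. {w \<in> \<bbbD>. pseudo_dist a w < R})"
      using sub assms by auto
  qed auto
  then show thesis
    using that sub by blast
qed

text \<open>The intermediate points lie on the geodesic segment, which is a radius once \<open>z\<close> is moved
  to the origin.\<close>

lemma pseudo_chain:
  assumes "s < 1" "0 < \<epsilon>"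
  obtains n :: nat where "\<And>z w. z \<in> \<bbbD> \<Longrightarrow> w \<in> \<bbbD> \<Longrightarrow> pseudo_dist z w \<le> s \<Longrightarrow>
    \<exists>x. x 0 = z \<and> x n = w \<and> (\<forall>k\<le>n. x k \<in> \<bbbD>) \<and> (\<forall>k<n. pseudo_dist (x k) (x (Suc k)) \<le> \<epsilon>)"
proof -
  \<comment> \<open>With \<open>n\<close> equal Euclidean steps, the numerator of each
    pseudohyperbolic distance is at most \<open>1 / n\<close> and the denominator at least
    \<open>1 - s\<close>.\<close>
  obtain n :: nat where n: "1 / (\<epsilon> * (1 - s)) < real n"
    using reals_Archimedean2 by blast
  have "0 < 1 / (\<epsilon> * (1 - s))"
    using assms by simp
  then have n0: "0 < n"
    using n by (metis less_trans of_nat_0_less_iff)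
  have "\<exists>x. x 0 = z \<and> x n = w \<and> (\<forall>k\<le>n. x k \<in> \<bbbD>) \<and> (\<forall>k<n. pseudo_dist (x k) (x (Suc k)) \<le> \<epsilon>)"
    if zw: "z \<in> \<bbbD>" "w \<in> \<bbbD>" "pseudo_dist z w \<le> s" for z w
  proof -
    define u where "u = disk_shift z w"
    define y where "y k = of_real (real k / real n) * u" for k
    have u: "cmod u \<le> s" "u \<in> \<bbbD>" "0 \<le> s"
      using zw u_def disk_shift_in_disk norm_ge_zero[of u] by (auto simp del: norm_ge_zero)
    have ys: "cmod (y k) \<le> s" if "k \<le> n" for k
    proof -
      have "cmod (y k) = real k / real n * cmod u"
        by (simp add: y_def norm_mult norm_divide)
      also have "\<dots> \<le> 1 * s"
        using u that n0 by (intro mult_mono) auto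
      finally show ?thesis by simp
    qed
    then have yD: "y k \<in> \<bbbD>" if "k \<le> n" for k
      using assms that by fastforce
    have z': "- z \<in> \<bbbD>" using zw by simp
    have step: "pseudo_dist (y k) (y (Suc k)) \<le> \<epsilon>" if "k < n" for k
    proof -
      have "y (Suc k) - y k = u / of_nat n"
        using n0 by (simp add: y_def field_simps)
      then have 1: "cmod (y (Suc k) - y k) \<le> 1 / real n"
        using u(2) n0 by (simp add: norm_divide divide_right_mono)
      have "cmod (cnj (y k) * y (Suc k)) \<le> s * 1"
        unfolding norm_mult using ys[of k] ys[of "Suc k"] that assms u(3)
        by (intro mult_mono) auto
      then have "1 - s \<le> cmod (1 - cnj (y k) * y (Suc k))"
        using norm_triangle_ineq2[of 1 "cnj (y k) * y (Suc k)"] by simp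
      then have "pseudo_dist (y k) (y (Suc k)) \<le> (1 / real n) / (1 - s)"
        unfolding disk_shift_def norm_divide using 1 assms by (intro frac_le) auto
      also have "\<dots> \<le> \<epsilon>"
        using n assms n0 by (simp add: field_simps)
      finally show ?thesis .
    qed
    show ?thesis
    proof (intro exI[of _ "\<lambda>k. disk_shift (- z) (y k)"] conjI allI impI)
      show "disk_shift (- z) (y 0) = z"
        by (simp add: y_def)
      show "disk_shift (- z) (y n) = w"
        using n0 zw by (simp add: y_def u_def disk_shift_inverse)
      show "disk_shift (- z) (y k) \<in> \<bbbD>" if "k \<le> n" for k
        using yD[OF that] z' by (rule disk_shift_in_disk[rotated])
      show "pseudo_dist (disk_shift (- z) (y k)) (disk_shift (- z) (y (Suc k))) \<le> \<epsilon>" if "k < n" for k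
        using step[OF that] yD[of k] yD[of "Suc k"] that z' by (simp only: pseudo_dist_disk_shift)
    qed
  qed
  then show thesis
    using that by blast
qed

section \<open>Subharmonic functions\<close>

text \<open>The mean value property, from Cauchy's integral formula on the circle: multiplying by
  \<open>- \<i>\<close> cancels the factor \<open>\<i>\<close> of the parametrized differential, and
  then real parts are taken.\<close>

lemma holomorphic_circle_mean_Re:
  assumes "F holomorphic_on ball z \<epsilon>" "0 < r" "r < \<epsilon>"
  shows "set_integrable lborel {0..2 * pi} (\<lambda>\<theta>. Re (F (z + of_real r * cis \<theta>)))"
    and "(LBINT \<theta>:{0..2 * pi}. Re (F (z + of_real r * cis \<theta>))) = 2 * pi * Re (F z)"
proof -
  have "F holomorphic_on cball z r"
    using assms(1) by (rule holomorphic_on_subset) (use assms in auto)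
  then have "((\<lambda>u. F u / (u - z)) has_contour_integral (2 * of_real pi * \<i> * F z)) (circlepath z r)"
    using assms by (intro Cauchy_integral_circlepath_simple) auto
  then have "((\<lambda>t. F (z + r * cis t) / (z + r * cis t - z) * r * \<i> * cis t) has_integral (2 * of_real pi * \<i> * F z)) {0..2 * pi}"
    using has_contour_integral_part_circlepath_iff[of 0 "2 * pi" "\<lambda>u. F u / (u - z)"]
    unfolding circlepath_def by simp
  from has_integral_mult_right[OF this, of "- \<i>"]
  have int: "((\<lambda>t. - \<i> * (F (z + r * cis t) / (z + r * cis t - z) * r * \<i> * cis t)) has_integral
      - \<i> * (2 * of_real pi * \<i> * F z)) {0..2 * pi}" .
  have 1: "- \<i> * (F (z + r * cis t) / (z + r * cis t - z) * r * \<i> * cis t) = F (z + r * cis t)" for t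
    using assms(2) by (simp add: field_simps)
  have 2: "- \<i> * (2 * of_real pi * \<i> * F z) = 2 * of_real pi * F z"
    by (simp add: field_simps)
  have "((\<lambda>t. F (z + r * cis t)) has_integral (2 * of_real pi * F z)) {0..2 * pi}"
    using int unfolding 1 2 .
  from has_integral_Re[OF this]
  have int: "((\<lambda>t. Re (F (z + r * cis t))) has_integral (2 * pi * Re (F z))) {0..2 * pi}"
    by simp
  have "continuous_on {0..2 * pi} (\<lambda>t. F (z + r * cis t))"
    by (rule continuous_on_compose2[OF holomorphic_on_imp_continuous_on[OF assms(1)]])
      (use assms in \<open>auto simp: dist_norm norm_mult intro!: continuous_intros\<close>)
  then show si: "set_integrable lborel {0..2 * pi} (\<lambda>\<theta>. Re (F (z + of_real r * cis \<theta>)))"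
    by (intro borel_integrable_atLeastAtMost' continuous_intros)
  show "(LBINT \<theta>:{0..2 * pi}. Re (F (z + of_real r * cis \<theta>))) = 2 * pi * Re (F z)"
    using set_borel_integral_eq_integral(2)[OF si] int by (simp add: integral_unique)
qed

text \<open>At a zero of \<open>g\<close> the sub-mean inequality is trivial because
  \<open>g\<close> is nonnegative. Elsewhere \<open>Re F\<close> touches \<open>g\<close> from below
  at \<open>z\<close> and equals its own circle means, so those of \<open>g\<close> are at least
  \<open>g z\<close>.\<close>

lemma subharmonic_on_local_minorant:
  assumes "open S" and cont: "continuous_on S g" and nonneg: "\<And>z. z \<in> S \<Longrightarrow> 0 \<le> g z"
    and minorant: "\<And>z. z \<in> S \<Longrightarrow> 0 < g z \<Longrightarrow>
      \<exists>\<epsilon>>0. \<exists>F. F holomorphic_on ball z \<epsilon> \<and> g z = Re (F z) \<and> (\<forall>w\<in>ball z \<epsilon>. Re (F w) \<le> g w)"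
  shows "subharmonic_on g S"
  unfolding subharmonic_on_def
proof (intro conjI ballI allI impI)
  fix z c assume z: "z \<in> S" "g z < c"
  have "(g \<longlongrightarrow> g z) (at z)"
    using cont \<open>open S\<close> z(1) by (simp add: continuous_on_eq_continuous_at isCont_def)
  then show "\<forall>\<^sub>F w in at z. g w < c"
    using z(2) by (rule order_tendstoD)
next
  fix z assume z: "z \<in> S"
  obtain R0 where R0: "0 < R0" "ball z R0 \<subseteq> S"
    using \<open>open S\<close> z openE by blast
  have circ: "z + of_real r * cis \<theta> \<in> ball z \<rho>" if "0 < r" "r < \<rho>" for r \<rho> \<theta>
    using that by (simp add: dist_norm norm_mult)
  have si: "set_integrable lborel {0..2 * pi} (\<lambda>\<theta>. g (z + of_real r * cis \<theta>))"
    if "0 < r" "r < R0" for r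
  proof -
    have "continuous_on {0..2 * pi} (\<lambda>t. g (z + r * cis t))"
      by (rule continuous_on_compose2[OF cont]) (use circ[OF that] R0 in \<open>auto intro!: continuous_intros\<close>)
    then show ?thesis
      by (rule borel_integrable_atLeastAtMost')
  qed
  show "\<exists>R>0. \<forall>r. 0 < r \<and> r < R \<longrightarrow>
        set_integrable lborel {0..2 * pi} (\<lambda>\<theta>. g (z + of_real r * cis \<theta>)) \<and>
        g z \<le> 1 / (2 * pi) * (LBINT \<theta>:{0..2 * pi}. g (z + of_real r * cis \<theta>))"
  proof (cases "g z = 0")
    case True
    show ?thesis
    proof (intro exI[of _ R0] conjI allI impI R0)
      fix r assume r: "0 < r \<and> r < R0"
      then show "set_integrable lborel {0..2 * pi} (\<lambda>\<theta>. g (z + of_real r * cis \<theta>))"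
        using si by blast
      have "0 \<le> (LBINT \<theta>:{0..2 * pi}. g (z + of_real r * cis \<theta>))"
        unfolding set_lebesgue_integral_def using circ r R0 nonneg
        by (intro Bochner_Integration.integral_nonneg) (auto simp: indicator_def subset_iff)
      then show "g z \<le> 1 / (2 * pi) * (LBINT \<theta>:{0..2 * pi}. g (z + of_real r * cis \<theta>))"
        using True by simp
    qed
  next
    case False
    then have "0 < g z"
      using nonneg z by (simp add: less_le)
    then obtain \<epsilon> F where F: "0 < \<epsilon>" "F holomorphic_on ball z \<epsilon>" "g z = Re (F z)"
      "\<And>w. w \<in> ball z \<epsilon> \<Longrightarrow> Re (F w) \<le> g w"
      using minorant z by blast
    show ?thesis
    proof (intro exI[of _ "min R0 \<epsilon>"] conjI allI impI)
      fix r assume r: "0 < r \<and> r < min R0 \<epsilon>"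
      then show gi: "set_integrable lborel {0..2 * pi} (\<lambda>\<theta>. g (z + of_real r * cis \<theta>))"
        using si by simp
      have "2 * pi * g z = (LBINT \<theta>:{0..2 * pi}. Re (F (z + of_real r * cis \<theta>)))"
        using holomorphic_circle_mean_Re(2)[OF F(2)] F(3) r by simp
      also have "\<dots> \<le> (LBINT \<theta>:{0..2 * pi}. g (z + of_real r * cis \<theta>))"
        using holomorphic_circle_mean_Re(1)[OF F(2)] gi r F(4) circ
        by (intro set_integral_mono) auto
      finally show "g z \<le> 1 / (2 * pi) * (LBINT \<theta>:{0..2 * pi}. g (z + of_real r * cis \<theta>))"
        by (simp add: field_simps)
    qed (use R0 F in auto)
  qed
qed (rule \<open>open S\<close>)

text \<open>Near a point with \<open>f z \<noteq> 0\<close> a holomorphic branch of the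
  \<open>p\<close>-th power of \<open>f\<close> exists, and its real part stays below its
  modulus.\<close>

lemma subharmonic_on_cmod_powr:
  assumes "open S" and hol: "f holomorphic_on S" and "0 < p"
  shows "subharmonic_on (\<lambda>z. cmod (f z) powr p) S"
proof (rule subharmonic_on_local_minorant)
  show "continuous_on S (\<lambda>z. cmod (f z) powr p)"
    using holomorphic_on_imp_continuous_on[OF hol] \<open>0 < p\<close>
    by (intro continuous_on_powr' continuous_intros) auto
next
  fix z assume z: "z \<in> S" "0 < cmod (f z) powr p"
  then have fz: "f z \<noteq> 0" by auto
  have cont: "continuous_on S f"
    using hol by (rule holomorphic_on_imp_continuous_on)
  have "open (S \<inter> f -` (- {0}))"
    using cont \<open>open S\<close> by (intro continuous_open_preimage) auto
  then obtain \<epsilon> where \<epsilon>: "0 < \<epsilon>" "ball z \<epsilon> \<subseteq> S \<inter> f -` (- {0})"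
    using z fz openE by (metis ComplI Int_iff singletonD vimage_eq)
  have "f holomorphic_on ball z \<epsilon>"
    using hol \<epsilon> by (meson holomorphic_on_subset Int_subset_iff)
  then obtain L where L: "L holomorphic_on ball z \<epsilon>" "\<And>w. w \<in> ball z \<epsilon> \<Longrightarrow> exp (L w) = f w"
    using holomorphic_logarithm_exists[of "ball z \<epsilon>" f z] \<epsilon> by (auto simp: subset_iff)
  \<comment> \<open>Subtracting \<open>\<i> * Im (L z)\<close> rotates the branch so that
    \<open>F z\<close> is positive; this gives the equality \<open>Re (F z) = cmod (F z)\<close> at
    the centre.\<close>
  define F where "F w = exp (of_real p * (L w - \<i> * of_real (Im (L z))))" for w
  have cF: "cmod (F w) = cmod (f w) powr p" if "w \<in> ball z \<epsilon>" for w
    using L(2)[OF that, symmetric] by (simp add: F_def powr_def)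
  have "F z = of_real (exp (p * Re (L z)))"
    unfolding F_def by (simp add: complex_eq_iff Re_exp Im_exp)
  then have "Re (F z) = cmod (F z)"
    by simp
  moreover have "F holomorphic_on ball z \<epsilon>"
    unfolding F_def by (intro holomorphic_intros L)
  ultimately show "\<exists>\<epsilon>>0. \<exists>F. F holomorphic_on ball z \<epsilon> \<and> cmod (f z) powr p = Re (F z) \<and>
      (\<forall>w\<in>ball z \<epsilon>. Re (F w) \<le> cmod (f w) powr p)"
    using \<epsilon>(1) cF complex_Re_le_cmod by (metis centre_in_ball)
qed (use assms in auto)

text \<open>The function \<open>Re ((\<zeta> + d)\<^sup>2)\<close> on the sector \<open>\<bar>arg (\<zeta> + d)\<bar> < \<pi> / 4\<close>, and 0 elsewhere.\<close>

definition sector_fun :: "real \<Rightarrow> complex \<Rightarrow> real" where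
  "sector_fun d \<zeta> = max 0 ((Re \<zeta> + d) * \<bar>Re \<zeta> + d\<bar> - (Im \<zeta>)\<^sup>2)"

text \<open>The absolute value in \<open>sector_fun\<close> suppresses the opposite sector: the
  function vanishes for \<open>Re \<zeta> + d \<le> 0\<close>. On the other half-plane it is the
  positive part of the real part of \<open>(\<zeta> + d)\<^sup>2\<close>, which provides the
  minorant.\<close>

lemma subharmonic_on_sector_fun:
  assumes "open S" and hol: "\<phi> holomorphic_on S"
  shows "subharmonic_on (\<lambda>z. sector_fun d (\<phi> z)) S"
proof (rule subharmonic_on_local_minorant)
  have cont: "continuous_on S \<phi>"
    using hol by (rule holomorphic_on_imp_continuous_on)
  show "continuous_on S (\<lambda>z. sector_fun d (\<phi> z))"
    unfolding sector_fun_def by (intro continuous_intros cont)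
  fix z assume z: "z \<in> S" "0 < sector_fun d (\<phi> z)"
  have pos: "0 < Re (\<phi> z) + d"
  proof (rule ccontr)
    assume "\<not> ?thesis"
    then have "(Re (\<phi> z) + d) * \<bar>Re (\<phi> z) + d\<bar> \<le> 0"
      by (intro mult_nonpos_nonneg) auto
    moreover have "0 \<le> (Im (\<phi> z))\<^sup>2"
      by simp
    ultimately show False
      using z unfolding sector_fun_def by linarith
  qed
  have "open (S \<inter> (\<lambda>w. Re (\<phi> w) + d) -` {0<..})"
    using \<open>open S\<close> by (intro continuous_open_preimage continuous_intros cont) auto
  then obtain \<epsilon> where \<epsilon>: "0 < \<epsilon>" "ball z \<epsilon> \<subseteq> S \<inter> (\<lambda>w. Re (\<phi> w) + d) -` {0<..}"
    using z(1) pos openE by (metis IntI greaterThan_iff vimageI)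
  define F where "F w = (\<phi> w + of_real d)\<^sup>2" for w
  have ReF: "Re (F w) = (Re (\<phi> w) + d)\<^sup>2 - (Im (\<phi> w))\<^sup>2" for w
    by (simp add: F_def power2_eq_square)
  have "F holomorphic_on ball z \<epsilon>"
    unfolding F_def using \<epsilon>(2) by (intro holomorphic_intros holomorphic_on_subset[OF hol]) auto
  moreover have "Re (F z) = sector_fun d (\<phi> z)"
    using z(2) pos unfolding ReF sector_fun_def by (auto simp: power2_eq_square max_def split: if_splits)
  moreover have "Re (F w) \<le> sector_fun d (\<phi> w)" if "w \<in> ball z \<epsilon>" for w
  proof -
    have "0 < Re (\<phi> w) + d"
      using that \<epsilon>(2) by auto
    then show ?thesis
      unfolding ReF sector_fun_def by (simp add: power2_eq_square)
  qed
  ultimately show "\<exists>\<epsilon>>0. \<exists>F. F holomorphic_on ball z \<epsilon> \<and> sector_fun d (\<phi> z) = Re (F z) \<and>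
      (\<forall>w\<in>ball z \<epsilon>. Re (F w) \<le> sector_fun d (\<phi> w))"
    using \<epsilon>(1) by (intro exI[of _ \<epsilon>] exI[of _ F]) auto
qed (auto simp: sector_fun_def \<open>open S\<close>)

lemma sector_fun_le:
  assumes "0 \<le> d" "cmod \<zeta> \<le> R"
  shows "sector_fun d \<zeta> \<le> (R + d)\<^sup>2"
proof -
  have "\<bar>Re \<zeta> + d\<bar> \<le> R + d"
    using assms abs_Re_le_cmod[of \<zeta>] by linarith
  then have "\<bar>Re \<zeta> + d\<bar>\<^sup>2 \<le> (R + d)\<^sup>2"
    by (intro power_mono) auto
  moreover have "(Re \<zeta> + d) * \<bar>Re \<zeta> + d\<bar> \<le> \<bar>Re \<zeta> + d\<bar>\<^sup>2"
    unfolding power2_eq_square by (intro mult_right_mono) auto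
  moreover have "0 \<le> (Im \<zeta>)\<^sup>2" "0 \<le> (R + d)\<^sup>2"
    by auto
  ultimately show ?thesis
    unfolding sector_fun_def by linarith
qed

text \<open>The sector has its vertex at \<open>- d\<close> and opens to the right. To the right of
  \<open>e\<close>, a point within \<open>R\<close> of the origin is also within \<open>R\<close> of
  \<open>e\<close>; to the left of \<open>e\<close>, the sector leaves only points so close to the
  origin that \<open>e\<close> is near as well.\<close>

lemma sector_fun_pos_imp:
  fixes d e R :: real
  assumes "0 \<le> e" "e \<le> d" "4 * d \<le> R" "0 < R" "R < 1" "cmod \<zeta> < R" "0 < sector_fun d \<zeta>"
  shows "pseudo_dist (of_real e) \<zeta> < R"
proof -
  define x y where "x = Re \<zeta>" and "y = Im \<zeta>"
  have \<zeta>: "x\<^sup>2 + y\<^sup>2 < R\<^sup>2"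
    using power_strict_mono[OF assms(6), of 2] by (simp add: cmod_power2 x_def y_def)
  have h: "y\<^sup>2 < (x + d) * \<bar>x + d\<bar>"
    using assms(7) by (auto simp: sector_fun_def x_def y_def max_def split: if_splits)
  have xd: "0 < x + d"
  proof (rule ccontr)
    assume "\<not> ?thesis"
    then have "(x + d) * \<bar>x + d\<bar> \<le> 0"
      by (intro mult_nonpos_nonneg) auto
    then show False
      using h zero_le_power2[of y] by linarith
  qed
  then have "\<bar>x + d\<bar> = x + d"
    by simp
  with h have h: "y\<^sup>2 < (x + d)\<^sup>2"
    by (metis power2_eq_square)
  have e1: "e < 1" "0 \<le> d"
    using assms by auto
  have R1: "R\<^sup>2 < 1"
    using assms by (simp add: power_less_one_iff)
  \<comment> \<open>This is the claim in coordinates: the square of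
    \<open>cmod (\<zeta> - e)\<close> against \<open>R\<^sup>2\<close> times that of
    \<open>cmod (1 - e * \<zeta>)\<close>, with terms collected.\<close>
  have key: "(x\<^sup>2 + y\<^sup>2) * (1 - R\<^sup>2 * e\<^sup>2) + e\<^sup>2 - R\<^sup>2 < 2 * e * (1 - R\<^sup>2) * x"
  proof (cases "e \<le> x")
    case True
    have "0 < 1 - R\<^sup>2 * e\<^sup>2"
    proof -
      have "R\<^sup>2 * e\<^sup>2 \<le> R\<^sup>2 * 1"
        using assms e1 by (intro mult_left_mono) (auto simp: power_le_one)
      then show ?thesis using R1 by simp
    qed
    then have "(x\<^sup>2 + y\<^sup>2) * (1 - R\<^sup>2 * e\<^sup>2) < R\<^sup>2 * (1 - R\<^sup>2 * e\<^sup>2)"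
      using \<zeta> by (intro mult_strict_right_mono)
    moreover have "R\<^sup>2 * (1 - R\<^sup>2 * e\<^sup>2) + e\<^sup>2 - R\<^sup>2 = e * e * (1 - R\<^sup>2) * (1 + R\<^sup>2)"
      by (simp add: power2_eq_square algebra_simps)
    ultimately have "(x\<^sup>2 + y\<^sup>2) * (1 - R\<^sup>2 * e\<^sup>2) + e\<^sup>2 - R\<^sup>2 < e * e * (1 - R\<^sup>2) * (1 + R\<^sup>2)"
      by linarith
    also have "\<dots> \<le> e * e * (1 - R\<^sup>2) * 2"
      using R1 by (intro mult_left_mono) auto
    also have "\<dots> = 2 * e * (1 - R\<^sup>2) * e"
      by simp
    also have "\<dots> \<le> 2 * e * (1 - R\<^sup>2) * x"
      using True R1 assms by (intro mult_left_mono) auto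
    finally show ?thesis .
  next
    case False
    \<comment> \<open>Here \<open>- d < x < e \<le> d\<close>, so the sector condition gives
      \<open>\<bar>y\<bar> < 2 * d\<close>. The terms to be absorbed add up to at most
      \<open>(5 + 1 + 2) * d\<^sup>2\<close>, which is at most half of \<open>R\<^sup>2\<close>
      since \<open>4 * d \<le> R\<close>.\<close>
    have xs: "x\<^sup>2 \<le> d\<^sup>2"
      using False xd assms(2) by (intro abs_le_square_iff[THEN iffD1]) auto
    have "(x + d)\<^sup>2 \<le> (2 * d)\<^sup>2"
      using False xd assms(2) by (intro power_mono) auto
    then have "x\<^sup>2 + y\<^sup>2 \<le> 5 * d\<^sup>2"
      using h xs by (simp add: power_mult_distrib)
    moreover have "(x\<^sup>2 + y\<^sup>2) * (1 - R\<^sup>2 * e\<^sup>2) \<le> x\<^sup>2 + y\<^sup>2"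
      by (intro mult_left_le) auto
    ultimately have "(x\<^sup>2 + y\<^sup>2) * (1 - R\<^sup>2 * e\<^sup>2) \<le> 5 * d\<^sup>2"
      by (rule order_trans[rotated])
    moreover have "e\<^sup>2 \<le> d\<^sup>2"
      using assms(1,2) by (intro power_mono) auto
    moreover have "16 * d\<^sup>2 \<le> R\<^sup>2"
      using power_mono[OF assms(3), of 2] e1 by (simp add: power_mult_distrib)
    moreover have "- (2 * e * (1 - R\<^sup>2) * x) \<le> 2 * d\<^sup>2"
    proof -
      define c where "c = 1 - R\<^sup>2"
      have c: "0 \<le> c" "c \<le> 1"
        using R1 by (auto simp: c_def)
      have "(e * c) * (- x) \<le> (e * c) * d"
        using assms(1) c xd by (intro mult_left_mono mult_nonneg_nonneg) auto
      also have "\<dots> \<le> d * d"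
        using assms(1,2) c mult_left_le[of c e] by (intro mult_right_mono) auto
      finally show ?thesis
        unfolding c_def[symmetric] power2_eq_square[of d] by linarith
    qed
    moreover have "0 < R\<^sup>2"
      using assms by simp
    ultimately show ?thesis
      by linarith
  qed
  have "\<zeta> \<in> \<bbbD>" "complex_of_real e \<in> \<bbbD>"
    using assms e1 by auto
  then have nz: "cmod (1 - cnj (of_real e) * \<zeta>) \<noteq> 0"
    using one_minus_cnj_mult_nonzero by (metis norm_eq_zero)
  have "(cmod (\<zeta> - of_real e))\<^sup>2 < R\<^sup>2 * (cmod (1 - cnj (of_real e) * \<zeta>))\<^sup>2"
  proof -
    have 1: "(cmod (\<zeta> - of_real e))\<^sup>2 = (x\<^sup>2 + y\<^sup>2) - 2 * e * x + e\<^sup>2"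
      unfolding cmod_power2 by (simp add: x_def y_def power2_diff)
    have 2: "(cmod (1 - cnj (of_real e) * \<zeta>))\<^sup>2 = 1 - 2 * e * x + e\<^sup>2 * (x\<^sup>2 + y\<^sup>2)"
      unfolding cmod_power2 by (simp add: x_def y_def power2_diff power_mult_distrib distrib_left)
    show ?thesis
      unfolding 1 2 using key by (simp add: algebra_simps)
  qed
  then have "cmod (\<zeta> - of_real e) < R * cmod (1 - cnj (of_real e) * \<zeta>)"
    using assms by (intro power2_less_imp_less[of _ "R * _"]) (auto simp: power_mult_distrib)
  then show ?thesis
    using nz unfolding disk_shift_def norm_divide by (simp add: divide_less_eq)
qed

section \<open>Dyadic boxes\<close>

lemma borel_measurable_Arg2pi [measurable]: "Arg2pi \<in> borel_measurable borel"
  unfolding borel_measurable_iff_le using closed_Arg2pi2pi_le by auto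

lemma Arg2pi_cis:
  assumes "z \<noteq> 0" "0 \<le> t" "t < 1"
  shows "z = of_real (cmod z) * cis (2 * pi * t) \<longleftrightarrow> Arg2pi z = 2 * pi * t"
proof
  assume "z = of_real (cmod z) * cis (2 * pi * t)"
  then show "Arg2pi z = 2 * pi * t"
    using assms by (intro Arg2pi_unique[of "cmod z"]) (auto simp: cis_conv_exp)
next
  assume "Arg2pi z = 2 * pi * t"
  then show "z = of_real (cmod z) * cis (2 * pi * t)"
    using Arg2pi_eq[of z] by (simp add: cis_conv_exp)
qed

lemma dyadic_interval_bounds:
  assumes "m < 2 ^ j" "t \<in> dyadic_interval j m"
  shows "0 \<le> t" "t < 1"
proof -
  have "real (m + 1) \<le> 2 ^ j"
    using assms(1) by (metis Suc_eq_plus1 Suc_leI of_nat_le_iff of_nat_numeral of_nat_power)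
  then have "real (m + 1) / 2 ^ j \<le> 1"
    by simp
  moreover have "real m / 2 ^ j \<le> t" "t < real (m + 1) / 2 ^ j"
    using assms(2) unfolding dyadic_interval_def by auto
  ultimately show "0 \<le> t" "t < 1"
    using order_trans[of 0 "real m / 2 ^ j" t] by (auto intro: less_le_trans)
qed

text \<open>Expresses the angular condition through the measurable function \<open>Arg2pi\<close>.
  At the origin every \<open>t\<close> satisfies the original condition, hence the separate
  disjunct.\<close>

lemma dyadic_box_eq:
  assumes "m < 2 ^ j"
  shows "dyadic_box j m = {z \<in> \<bbbD>. (z = 0 \<or> Arg2pi z / (2 * pi) \<in> dyadic_interval j m) \<and>
              1 - 1 / 2 ^ j \<le> cmod z \<and> cmod z < 1 - (1 / 2 ^ j) / 2}"
proof -
  have "(\<exists>t\<in>dyadic_interval j m. z = of_real (cmod z) * cis (2 * pi * t)) \<longleftrightarrow>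
      z = 0 \<or> Arg2pi z / (2 * pi) \<in> dyadic_interval j m" for z
  proof (cases "z = 0")
    case True
    have "real m / 2 ^ j \<in> dyadic_interval j m"
      by (simp add: dyadic_interval_def divide_strict_right_mono)
    then show ?thesis
      using True by auto
  next
    case False
    then have "(\<exists>t\<in>dyadic_interval j m. z = of_real (cmod z) * cis (2 * pi * t)) \<longleftrightarrow>
        (\<exists>t\<in>dyadic_interval j m. Arg2pi z = 2 * pi * t)"
      using Arg2pi_cis dyadic_interval_bounds[OF assms] by blast
    also have "\<dots> \<longleftrightarrow> (\<exists>t\<in>dyadic_interval j m. Arg2pi z / (2 * pi) = t)"
      by (simp add: field_simps)
    finally show ?thesis
      using False by simp
  qed
  then show ?thesis
    by (simp add: dyadic_box_def)
qed

lemma borel_dyadic_box: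
  assumes "m < 2 ^ j"
  shows "dyadic_box j m \<in> sets borel"
proof -
  have *: "dyadic_box j m = {z. z \<in> \<bbbD> \<and> (z = 0 \<or> real m / 2 ^ j \<le> Arg2pi z / (2 * pi) \<and> Arg2pi z / (2 * pi) < real (m + 1) / 2 ^ j) \<and>
              1 - 1 / 2 ^ j \<le> cmod z \<and> cmod z < 1 - (1 / 2 ^ j) / 2}"
    unfolding dyadic_box_eq[OF assms] dyadic_interval_def by simp
  show ?thesis
    unfolding * mem_ball_0 by measurable
qed

section \<open>The boxes partition the disk\<close>

lemma dyadic_interval_floor:
  assumes "t \<in> dyadic_interval j m"
  shows "\<lfloor>t * 2 ^ j\<rfloor> = int m"
  using assms by (intro floor_unique) (auto simp: dyadic_interval_def field_simps)

lemma dyadic_level_unique: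
  fixes q :: real
  assumes "q \<le> 1 / 2 ^ j" "(1 / 2 ^ j) / 2 < q" "q \<le> 1 / 2 ^ k" "(1 / 2 ^ k) / 2 < q"
  shows "j = k"
proof -
  have *: "b \<le> a" if "q \<le> 1 / 2 ^ b" "(1 / 2 ^ a) / 2 < q" for a b :: nat
  proof (rule ccontr)
    assume "\<not> b \<le> a"
    then have "(2::real) ^ Suc a \<le> 2 ^ b"
      by (intro power_increasing) auto
    then have "1 / 2 ^ b \<le> 1 / (2::real) ^ Suc a"
      by (intro divide_left_mono) auto
    then show False
      using that by simp
  qed
  show ?thesis
    using *[of j k] *[of k j] assms by simp
qed

lemma dyadic_box_disjoint:
  assumes "m < 2 ^ j" "n < 2 ^ k" "z \<in> dyadic_box j m" "z \<in> dyadic_box k n"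
  shows "j = k \<and> m = n"
proof
  have z: "1 - cmod z \<le> 1 / 2 ^ j" "(1 / 2 ^ j) / 2 < 1 - cmod z"
      "1 - cmod z \<le> 1 / 2 ^ k" "(1 / 2 ^ k) / 2 < 1 - cmod z"
    using assms(3,4) by (auto simp: dyadic_box_def)
  then show jk: "j = k"
    by (rule dyadic_level_unique)
  show "m = n"
  proof (cases "z = 0")
    \<comment> \<open>The origin has \<open>1 - cmod z = 1\<close>, which forces level 0, where
      \<open>m = n = 0\<close> is the only index.\<close>
    case True
    then have "j = 0"
      using z by (intro dyadic_level_unique[of 1]) (auto simp: divide_less_eq)
    then show ?thesis
      using assms(1,2) jk by simp
  next
    case False
    then have "Arg2pi z / (2 * pi) \<in> dyadic_interval j m" "Arg2pi z / (2 * pi) \<in> dyadic_interval j n"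
      using assms jk by (auto simp: dyadic_box_eq)
    then show ?thesis
      by (metis dyadic_interval_floor of_nat_eq_iff)
  qed
qed

lemma dyadic_box_cover:
  assumes "z \<in> \<bbbD>"
  obtains j m where "m < 2 ^ j" "z \<in> dyadic_box j m"
proof -
  define q where "q = 1 - cmod z"
  have q: "0 < q" "q \<le> 1"
    using assms by (auto simp: q_def)
  define P where "P j \<longleftrightarrow> (1 / 2 ^ j) / 2 < q" for j :: nat
  obtain n :: nat where "(1 / 2) ^ n < q"
    using real_arch_pow_inv[of q "1 / 2"] q by auto
  then have "P n"
    using q by (simp add: P_def power_one_over)
  \<comment> \<open>\<open>P\<close> is the outer radial bound of the box at level \<open>j\<close>;
    its failure at the preceding level is the inner one.\<close>
  define j where "j = (LEAST j. P j)"
  have "P j"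
    unfolding j_def using \<open>P n\<close> by (rule LeastI)
  have "q \<le> 1 / 2 ^ j"
  proof (cases j)
    case 0
    then show ?thesis using q by simp
  next
    case (Suc i)
    then have "\<not> P i"
      unfolding j_def by (metis not_less_Least lessI)
    then show ?thesis
      using Suc by (simp add: P_def)
  qed
  define t where "t = Arg2pi z / (2 * pi)"
  have t: "0 \<le> t" "t < 1"
    using Arg2pi[of z] by (auto simp: t_def)
  define m where "m = nat \<lfloor>t * 2 ^ j\<rfloor>"
  have rm: "real m = of_int \<lfloor>t * 2 ^ j\<rfloor>"
    using t by (simp add: m_def)
  have "real m \<le> t * 2 ^ j" "t * 2 ^ j < real m + 1"
    unfolding rm by linarith+
  moreover have "t * 2 ^ j < 2 ^ j"
    using t by simp
  ultimately have "real m < real (2 ^ j)" "t \<in> dyadic_interval j m"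
    unfolding of_nat_power of_nat_numeral by (linarith, auto simp: dyadic_interval_def field_simps)
  then have "m < 2 ^ j" "t \<in> dyadic_interval j m"
    by (simp_all only: of_nat_less_iff)
  then have "z \<in> dyadic_box j m"
    using \<open>P j\<close> \<open>q \<le> 1 / 2 ^ j\<close> assms by (simp add: dyadic_box_eq q_def P_def t_def)
  with \<open>m < 2 ^ j\<close> show thesis
    by (rule that)
qed

text \<open>A common bound for the pseudohyperbolic diameters of all boxes. For a box with
  \<open>h = 1 / 2 ^ j\<close>, the number 1/324 is
  \<open>(h / 2)\<^sup>2 / (9 * h)\<^sup>2\<close>, in which the scale \<open>h\<close>
  cancels.\<close>

definition box_diameter :: real where
  "box_diameter = sqrt (1 - 1 / 324)"

lemma box_diameter: "0 \<le> box_diameter" "box_diameter < 1"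
  by (auto simp: box_diameter_def)

lemma cmod_one_minus_cis: "cmod (1 - cis x) \<le> \<bar>x\<bar>"
proof -
  have "cmod (cis x - 1) = 2 * \<bar>sin (x / 2)\<bar>"
    unfolding cis_conv_exp by (rule dist_exp_i_1)
  also have "\<dots> \<le> \<bar>x\<bar>"
    using abs_sin_x_le_abs_x[of "x / 2"] by simp
  finally show ?thesis
    by (simp add: norm_minus_commute)
qed

text \<open>Both \<open>1 - (cmod z)\<^sup>2\<close> and \<open>1 - (cmod w)\<^sup>2\<close> are at
  least \<open>h / 2\<close>, while \<open>1 - cnj z * w\<close> has modulus at most
  \<open>9 * h\<close>: \<open>2 * h\<close> from the radii and \<open>7 * h\<close> from the angle,
  as \<open>2 * pi < 7\<close>.\<close>

lemma pseudo_dist_dyadic_box: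
  assumes "z \<in> dyadic_box j m" "w \<in> dyadic_box j m"
  shows "pseudo_dist z w \<le> box_diameter"
proof -
  define h :: real where "h = 1 / 2 ^ j"
  have h: "0 < h" by (simp add: h_def)
  obtain s where s: "s \<in> dyadic_interval j m" "z = of_real (cmod z) * cis (2 * pi * s)"
    using assms by (auto simp: dyadic_box_def)
  obtain t where t: "t \<in> dyadic_interval j m" "w = of_real (cmod w) * cis (2 * pi * t)"
    using assms by (auto simp: dyadic_box_def)
  have D: "z \<in> \<bbbD>" "w \<in> \<bbbD>" and q: "1 - cmod z \<le> h" "h / 2 < 1 - cmod z" "1 - cmod w \<le> h" "h / 2 < 1 - cmod w"
    using assms by (auto simp: dyadic_box_def h_def)
  have "\<bar>t - s\<bar> \<le> h"
    using s(1) t(1) unfolding dyadic_interval_def h_def by (auto simp: field_simps abs_le_iff)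
  have "\<bar>2 * pi * t - 2 * pi * s\<bar> = 2 * pi * \<bar>t - s\<bar>"
    by (metis abs_mult abs_of_pos mult_pos_pos pi_gt_zero right_diff_distrib zero_less_numeral)
  also have "\<dots> \<le> 7 * h"
    using \<open>\<bar>t - s\<bar> \<le> h\<close> pi_less_4 pi_approx h by (intro mult_mono) auto
  finally have angle: "\<bar>2 * pi * t - 2 * pi * s\<bar> \<le> 7 * h" .
  define r where "r = cmod z * cmod w"
  have r: "0 \<le> r" "r \<le> 1"
    using D by (auto simp: r_def mult_le_one)
  have "0 \<le> (1 - cmod z) * (1 - cmod w)"
    using D by (intro mult_nonneg_nonneg) auto
  then have r2: "1 - r \<le> 2 * h"
    using q by (simp add: r_def algebra_simps)
  have "cnj z * w = of_real r * cis (2 * pi * t - 2 * pi * s)"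
    by (subst s(2), subst t(2)) (simp add: r_def cis_cnj cis_mult)
  \<comment> \<open>Separates the radial from the angular contribution.\<close>
  then have "1 - cnj z * w = of_real (1 - r) + of_real r * (1 - cis (2 * pi * t - 2 * pi * s))"
    by (simp add: algebra_simps)
  then have "cmod (1 - cnj z * w) \<le> cmod (of_real (1 - r)) + cmod (of_real r * (1 - cis (2 * pi * t - 2 * pi * s)))"
    by (metis norm_triangle_ineq)
  also have "\<dots> = (1 - r) + r * cmod (1 - cis (2 * pi * t - 2 * pi * s))"
    using r unfolding norm_mult norm_of_real by simp
  also have "\<dots> \<le> 2 * h + 1 * (7 * h)"
    using r r2 angle cmod_one_minus_cis[of "2 * pi * t - 2 * pi * s"] by (intro add_mono mult_mono) auto
  finally have "(cmod (1 - cnj z * w))\<^sup>2 \<le> (9 * h)\<^sup>2"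
    by (intro power_mono) auto
  moreover have *: "h / 2 \<le> 1 - (cmod u)\<^sup>2" if "h / 2 < 1 - cmod u" "u \<in> \<bbbD>" for u
    using that power_le_one[of "cmod u" 1] mult_left_le[of "cmod u" "cmod u"] by (simp add: power2_eq_square)
  ultimately have "(h / 2) * (h / 2) / (9 * h)\<^sup>2 \<le> (1 - (cmod z)\<^sup>2) * (1 - (cmod w)\<^sup>2) / (cmod (1 - cnj z * w))\<^sup>2"
    using one_minus_cnj_mult_nonzero[OF D] h *[OF q(2) D(1)] *[OF q(4) D(2)]
    by (intro frac_le mult_mono) auto
  also have "\<dots> = 1 - (pseudo_dist z w)\<^sup>2"
    using one_minus_pseudo_dist_sq[OF D] by simp
  finally have "(pseudo_dist z w)\<^sup>2 \<le> 1 - 1 / 324"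
    using h by (simp add: power2_eq_square field_simps)
  then show ?thesis
    unfolding box_diameter_def by (rule real_le_rsqrt)
qed

section \<open>Measures with the weighted sub-mean property\<close>

lemma borel_measure_on_disk_space: "borel_measure_on_disk \<mu> \<Longrightarrow> space \<mu> = \<bbbD>"
  unfolding borel_measure_on_disk_def
  by (drule sets_eq_imp_space_eq) (simp add: space_restrict_space)

lemma borel_measure_on_disk_sets:
  assumes "borel_measure_on_disk \<mu>" "A \<in> sets borel" "A \<subseteq> \<bbbD>"
  shows "A \<in> sets \<mu>"
  using assms unfolding borel_measure_on_disk_def by (auto simp: sets_restrict_space_iff)

lemma borel_measure_on_disk_measurable:
  fixes g :: "complex \<Rightarrow> real"
  assumes "borel_measure_on_disk \<mu>" "continuous_on \<bbbD> g"
  shows "g \<in> borel_measurable \<mu>"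
  using borel_measurable_continuous_on_restrict[OF assms(2)] assms(1)
    measurable_cong_sets[of \<mu> "restrict_space borel \<bbbD>" borel borel]
  unfolding borel_measure_on_disk_def by simp

lemma open_hyperbolic_ball: "z \<in> \<bbbD> \<Longrightarrow> open (hyperbolic_ball z r)"
  by (simp only: hyperbolic_ball_eq open_pseudo_ball)

lemma hyperbolic_ball_subset: "hyperbolic_ball z r \<subseteq> \<bbbD>"
  by (auto simp: hyperbolic_ball_def)

lemma sets_hyperbolic_ball:
  "borel_measure_on_disk \<mu> \<Longrightarrow> z \<in> \<bbbD> \<Longrightarrow> hyperbolic_ball z r \<in> sets \<mu>"
  by (rule borel_measure_on_disk_sets[OF _ borel_open[OF open_hyperbolic_ball] hyperbolic_ball_subset])

lemma centre_in_hyperbolic_ball: "z \<in> \<bbbD> \<Longrightarrow> 0 < r \<Longrightarrow> z \<in> hyperbolic_ball z r"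
  by (simp add: hyperbolic_ball_eq)

text \<open>Finitely many balls cover \<open>K\<close>. This makes every continuous function locally
  integrable, hence admissible in the sub-mean property.\<close>

lemma emeasure_compact_finite:
  assumes "borel_measure_on_disk \<mu>" "0 < r" "\<And>z. z \<in> \<bbbD> \<Longrightarrow> emeasure \<mu> (hyperbolic_ball z r) < \<infinity>"
    and "compact K" "K \<subseteq> \<bbbD>"
  shows "emeasure \<mu> K < \<infinity>"
proof -
  obtain F where F: "F \<subseteq> K" "finite F" "K \<subseteq> (\<Union>z\<in>F. hyperbolic_ball z r)"
  proof (rule compactE_image[OF \<open>compact K\<close>, of K "\<lambda>z. hyperbolic_ball z r"])
    show "open (hyperbolic_ball z r)" if "z \<in> K" for z
      using that assms by (intro open_hyperbolic_ball) auto
    show "K \<subseteq> (\<Union>z\<in>K. hyperbolic_ball z r)"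
    proof
      fix z assume "z \<in> K"
      then show "z \<in> (\<Union>z\<in>K. hyperbolic_ball z r)"
        using assms(2,5) centre_in_hyperbolic_ball[of z r] by blast
    qed
  qed auto
  have FD: "F \<subseteq> \<bbbD>"
    using F(1) assms(5) by blast
  then have sets: "hyperbolic_ball z r \<in> sets \<mu>" if "z \<in> F" for z
    using that assms(1) sets_hyperbolic_ball by blast
  have "emeasure \<mu> K \<le> emeasure \<mu> (\<Union>z\<in>F. hyperbolic_ball z r)"
    using F(2,3) sets by (intro emeasure_mono sets.finite_UN)
  also have "\<dots> \<le> (\<Sum>z\<in>F. emeasure \<mu> (hyperbolic_ball z r))"
    using F(2) sets by (intro emeasure_subadditive_finite) auto
  also have "\<dots> < \<infinity>"
    using FD F(2) assms(3) by (simp add: subset_iff)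
  finally show ?thesis .
qed

lemma locally_integrable_continuous:
  assumes "borel_measure_on_disk \<mu>" "\<And>K. compact K \<Longrightarrow> K \<subseteq> \<bbbD> \<Longrightarrow> emeasure \<mu> K < \<infinity>"
    and cont: "continuous_on \<bbbD> g"
  shows "locally_integrable_on_disk \<mu> g"
  unfolding locally_integrable_on_disk_def set_integrable_def
proof (intro allI impI, elim conjE)
  fix K assume K: "compact K" "K \<subseteq> \<bbbD>"
  have "bounded (g ` K)"
    by (rule compact_imp_bounded[OF compact_continuous_image[OF continuous_on_subset[OF cont K(2)] K(1)]])
  then obtain B where B: "\<And>z. z \<in> K \<Longrightarrow> norm (g z) \<le> B"
    unfolding bounded_iff by auto
  show "integrable \<mu> (\<lambda>x. indicator K x *\<^sub>R g x)"
  proof (rule integrableI_bounded_set_indicator[where B = B])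
    show "K \<in> sets \<mu>"
      by (rule borel_measure_on_disk_sets[OF assms(1) borel_closed[OF compact_imp_closed[OF K(1)]] K(2)])
    show "g \<in> borel_measurable \<mu>"
      using assms(1) cont by (rule borel_measure_on_disk_measurable)
    show "emeasure \<mu> K < \<infinity>"
      using assms(2) K .
    show "AE x in \<mu>. x \<in> K \<longrightarrow> norm (g x) \<le> B"
      using B by simp
  qed
qed

text \<open>Finiteness of the balls stands in for doubling here, so that constants derived from this
  notion can be chosen before the measure.\<close>

definition submean_measure :: "complex measure \<Rightarrow> real \<Rightarrow> real \<Rightarrow> bool" where
  "submean_measure \<mu> r0 Cws \<longleftrightarrow> borel_measure_on_disk \<mu> \<and> weighted_submean \<mu> r0 Cws \<and>
     (\<forall>z\<in>\<bbbD>. emeasure \<mu> (hyperbolic_ball z r0) < \<infinity>)"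

lemma ennreal_mult_le_of_le_divide:
  fixes x c m I :: ennreal
  assumes "x \<le> c / m * I" "m < \<infinity>"
  shows "x * m \<le> c * I"
proof (cases "m = 0")
  case False
  have "x * m \<le> (c / m * I) * m"
    using assms(1) by (rule mult_right_mono) simp
  also have "\<dots> = (c / m * m) * I"
    by (simp add: mult_ac)
  also have "c / m * m = c"
    using False assms(2) by (simp add: ennreal_divide_times ennreal_mult_divide_eq)
  finally show ?thesis .
qed simp

lemma submean_measure_apply:
  assumes "submean_measure \<mu> r0 Cws" "0 < r0" "subharmonic_on g \<bbbD>" "\<And>z. z \<in> \<bbbD> \<Longrightarrow> 0 \<le> g z"
    "continuous_on \<bbbD> g" "w \<in> \<bbbD>"
  shows "ennreal (g w) * emeasure \<mu> (hyperbolic_ball w r0) \<le>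
    ennreal Cws * (\<integral>\<^sup>+z\<in>hyperbolic_ball w r0. ennreal (g z) \<partial>\<mu>)"
proof (rule ennreal_mult_le_of_le_divide)
  have \<mu>: "borel_measure_on_disk \<mu>" "weighted_submean \<mu> r0 Cws"
    "\<And>z. z \<in> \<bbbD> \<Longrightarrow> emeasure \<mu> (hyperbolic_ball z r0) < \<infinity>"
    using assms(1) by (auto simp: submean_measure_def)
  have "locally_integrable_on_disk \<mu> g"
    using locally_integrable_continuous[OF \<mu>(1) _ assms(5)] emeasure_compact_finite[OF \<mu>(1) assms(2) \<mu>(3)]
    by blast
  then show "ennreal (g w) \<le> ennreal Cws / emeasure \<mu> (hyperbolic_ball w r0) *
           (\<integral>\<^sup>+z\<in>hyperbolic_ball w r0. ennreal (g z) \<partial>\<mu>)"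
    using \<mu>(2) assms unfolding weighted_submean_def by blast
  show "emeasure \<mu> (hyperbolic_ball w r0) < \<infinity>"
    using \<mu>(3) assms(6) .
qed

lemma subharmonic_on_const:
  assumes "open S" "0 \<le> c"
  shows "subharmonic_on (\<lambda>_. c) S"
  using assms by (intro subharmonic_on_local_minorant)
    (auto intro!: exI[of _ 1] exI[of _ "\<lambda>_. of_real c"])

text \<open>Tested on the constant 1, the sub-mean inequality at the centre of a null ball would
  read \<open>1 \<le> 0\<close>, since the integral on the right vanishes and
  \<open>\<infinity> * 0 = 0\<close>.\<close>

lemma submean_measure_ball_pos:
  assumes "submean_measure \<mu> r0 Cws" "0 < r0" "w \<in> \<bbbD>"
  shows "0 < emeasure \<mu> (hyperbolic_ball w r0)"
proof (rule ccontr)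
  assume "\<not> ?thesis"
  then have 0: "emeasure \<mu> (hyperbolic_ball w r0) = 0"
    by simp
  have \<mu>: "borel_measure_on_disk \<mu>" "weighted_submean \<mu> r0 Cws"
    "\<And>z. z \<in> \<bbbD> \<Longrightarrow> emeasure \<mu> (hyperbolic_ball z r0) < \<infinity>"
    using assms(1) by (auto simp: submean_measure_def)
  have "locally_integrable_on_disk \<mu> (\<lambda>_. 1)"
    using locally_integrable_continuous[OF \<mu>(1)] emeasure_compact_finite[OF \<mu>(1) assms(2) \<mu>(3)]
    by (metis continuous_on_const)
  then have "ennreal 1 \<le> ennreal Cws / emeasure \<mu> (hyperbolic_ball w r0) *
           (\<integral>\<^sup>+z\<in>hyperbolic_ball w r0. ennreal 1 \<partial>\<mu>)"
    using \<mu>(2)[unfolded weighted_submean_def, rule_format, of "\<lambda>_. 1" w] assms(3)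
      subharmonic_on_const[of \<bbbD> 1] by simp
  moreover have "(\<integral>\<^sup>+z\<in>hyperbolic_ball w r0. ennreal 1 \<partial>\<mu>) = 0"
    using 0 sets_hyperbolic_ball[OF \<mu>(1) assms(3)] by simp
  ultimately show False
    by simp
qed

section \<open>Comparability of nearby balls\<close>

lemma pseudo_dist_rotate:
  assumes "cmod c = 1"
  shows "pseudo_dist (c * a) (c * z) = pseudo_dist a z"
proof -
  have "cnj c * c = 1"
    using assms by (metis complex_norm_square mult.commute of_real_1 power_one)
  then have "cnj (c * a) * (c * z) = cnj a * z"
    unfolding complex_cnj_mult by (metis mult.assoc mult.commute mult_1)
  moreover have "c * z - c * a = c * (z - a)"
    by (simp add: algebra_simps)
  ultimately show ?thesis
    unfolding disk_shift_def norm_divide by (simp only: norm_mult assms mult_1)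
qed

text \<open>Testing the sub-mean property against the function supported in a sector that points from
  \<open>a\<close> towards \<open>b\<close>: inside the ball about \<open>a\<close>, this sector lies in the ball about \<open>b\<close>. In this
  way the doubling constants do not enter.\<close>

lemma submean_measure_step:
  assumes \<mu>: "submean_measure \<mu> r0 Cws" and r0: "0 < r0" and ab: "a \<in> \<bbbD>" "b \<in> \<bbbD>"
    "pseudo_dist a b \<le> tanh (r0 / 2) / 4"
  shows "emeasure \<mu> (hyperbolic_ball a r0) \<le> ennreal (25 * Cws) * emeasure \<mu> (hyperbolic_ball b r0)"
proof -
  define R d where "R = tanh (r0 / 2)" and "d = R / 4"
  have R: "0 < R" "R < 1" and d: "0 < d"
    using r0 by (auto simp: R_def d_def tanh_real_lt_1)
  define u where "u = disk_shift a b"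
  \<comment> \<open>After \<open>a\<close> has been moved to the origin, this rotation puts the
    image of \<open>b\<close> on the positive real axis, as \<open>sector_fun_pos_imp\<close>
    requires.\<close>
  obtain c where c: "cmod c = 1" "c * u = of_real (cmod u)"
  proof
    show "cmod (cis (- Arg u)) = 1"
      by simp
    show "cis (- Arg u) * u = of_real (cmod u)"
      using rcis_cmod_Arg[of u] unfolding rcis_def
      by (metis cis_mult cis_zero add.left_inverse mult.left_commute mult.right_neutral mult.commute)
  qed
  define g where "g z = sector_fun d (c * disk_shift a z)" for z
  have hol: "(\<lambda>z. c * disk_shift a z) holomorphic_on \<bbbD>"
    using ab(1) by (intro holomorphic_intros)
  have sub: "subharmonic_on g \<bbbD>"
    unfolding g_def using hol by (intro subharmonic_on_sector_fun) auto
  have cont: "continuous_on \<bbbD> g"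
    unfolding g_def sector_fun_def by (intro continuous_intros holomorphic_on_imp_continuous_on[OF hol])
  have nonneg: "0 \<le> g z" for z
    by (simp add: g_def sector_fun_def)
  have ga: "g a = d\<^sup>2"
    using d by (simp add: g_def sector_fun_def power2_eq_square)
  have meas: "hyperbolic_ball b r0 \<in> sets \<mu>"
    using \<mu> ab by (intro sets_hyperbolic_ball) (auto simp: submean_measure_def)
  \<comment> \<open>With \<open>R = 4 * d\<close>, the test function is at most
    \<open>(5 * d)\<^sup>2\<close> on the ball about \<open>a\<close>, against its value
    \<open>d\<^sup>2\<close> at \<open>a\<close>; the ratio is the constant 25.\<close>
  have le: "ennreal (g z) * indicator (hyperbolic_ball a r0) z \<le> ennreal (25 * d\<^sup>2) * indicator (hyperbolic_ball b r0) z" for z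
  proof (cases "z \<in> hyperbolic_ball a r0 \<and> 0 < g z")
    case False
    then show ?thesis
      using nonneg[of z] by (auto simp: indicator_def)
  next
    case True
    then have z: "z \<in> \<bbbD>" "cmod (c * disk_shift a z) < R"
      using ab(1) c(1) by (auto simp: hyperbolic_ball_eq R_def norm_mult)
    have "g z \<le> (R + d)\<^sup>2"
      unfolding g_def using z d by (intro sector_fun_le) auto
    also have "R + d = 5 * d"
      by (simp add: d_def)
    finally have "g z \<le> 25 * d\<^sup>2"
      by (simp add: power_mult_distrib)
    moreover have "pseudo_dist (of_real (cmod u)) (c * disk_shift a z) < R"
      using ab(3) R d z True unfolding g_def
      by (intro sector_fun_pos_imp[of _ d]) (auto simp: u_def R_def d_def)
    then have "pseudo_dist b z < R"
      unfolding c(2)[symmetric] pseudo_dist_rotate[OF c(1)]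
      unfolding u_def pseudo_dist_disk_shift[OF ab(1,2) z(1)] .
    then have "z \<in> hyperbolic_ball b r0"
      using z(1) hyperbolic_ball_eq[OF ab(2)] by (simp add: R_def)
    ultimately show ?thesis
      using True by (simp add: ennreal_leI)
  qed
  have "ennreal (d\<^sup>2) * emeasure \<mu> (hyperbolic_ball a r0) \<le>
      ennreal Cws * (\<integral>\<^sup>+z\<in>hyperbolic_ball a r0. ennreal (g z) \<partial>\<mu>)"
    using submean_measure_apply[OF \<mu> r0 sub nonneg cont ab(1)] by (simp add: ga)
  also have "\<dots> \<le> ennreal Cws * (\<integral>\<^sup>+z. ennreal (25 * d\<^sup>2) * indicator (hyperbolic_ball b r0) z \<partial>\<mu>)"
    by (intro mult_left_mono nn_integral_mono le) simp
  also have "\<dots> = ennreal Cws * (ennreal (25 * d\<^sup>2) * emeasure \<mu> (hyperbolic_ball b r0))"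
    using meas by (simp add: nn_integral_cmult_indicator)
  also have "\<dots> = ennreal (d\<^sup>2) * (ennreal (25 * Cws) * emeasure \<mu> (hyperbolic_ball b r0))"
  proof -
    have "ennreal Cws * ennreal (25 * d\<^sup>2) = ennreal (d\<^sup>2) * ennreal (25 * Cws)"
      by (simp add: ennreal_mult'[symmetric] ennreal_mult''[symmetric] mult_ac)
    then show ?thesis
      by (simp add: mult.assoc[symmetric])
  qed
  finally show ?thesis
    using d by (subst (asm) ennreal_mult_le_mult_iff) auto
qed

text \<open>Iterates the one-step comparison along a chain whose length depends on \<open>s\<close>
  and \<open>r0\<close> only; therefore \<open>A\<close> is chosen before the measure and the
  points.\<close>

lemma submean_measure_balls_comparable:
  assumes "0 < r0" "0 \<le> Cws" "s < 1"
  obtains A where "0 < A" "\<And>\<mu> z w. submean_measure \<mu> r0 Cws \<Longrightarrow> z \<in> \<bbbD> \<Longrightarrow> w \<in> \<bbbD> \<Longrightarrow> pseudo_dist z w \<le> s \<Longrightarrow>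
    emeasure \<mu> (hyperbolic_ball z r0) \<le> ennreal A * emeasure \<mu> (hyperbolic_ball w r0)"
proof -
  have "0 < tanh (r0 / 2) / 4"
    using assms(1) by simp
  then obtain n :: nat where chain: "\<And>z w. z \<in> \<bbbD> \<Longrightarrow> w \<in> \<bbbD> \<Longrightarrow> pseudo_dist z w \<le> s \<Longrightarrow>
    \<exists>x. x 0 = z \<and> x n = w \<and> (\<forall>k\<le>n. x k \<in> \<bbbD>) \<and> (\<forall>k<n. pseudo_dist (x k) (x (Suc k)) \<le> tanh (r0 / 2) / 4)"
    using pseudo_chain[OF assms(3)] by blast
  show thesis
  proof
    \<comment> \<open>Adding 1 keeps the constant positive even for \<open>Cws = 0\<close>.\<close>
    show "0 < (25 * Cws + 1) ^ n"
      using assms by simp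
    fix \<mu> z w assume \<mu>: "submean_measure \<mu> r0 Cws" and zw: "z \<in> \<bbbD>" "w \<in> \<bbbD>" "pseudo_dist z w \<le> s"
    obtain x where x: "x 0 = z" "x n = w" "\<And>k. k \<le> n \<Longrightarrow> x k \<in> \<bbbD>"
      "\<And>k. k < n \<Longrightarrow> pseudo_dist (x k) (x (Suc k)) \<le> tanh (r0 / 2) / 4"
      using chain[OF zw] by blast
    have "k \<le> n \<Longrightarrow> emeasure \<mu> (hyperbolic_ball z r0) \<le>
        ennreal ((25 * Cws + 1) ^ k) * emeasure \<mu> (hyperbolic_ball (x k) r0)" for k
    proof (induction k)
      case (Suc k)
      have "emeasure \<mu> (hyperbolic_ball z r0) \<le> ennreal ((25 * Cws + 1) ^ k) * emeasure \<mu> (hyperbolic_ball (x k) r0)"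
        using Suc by simp
      also have "\<dots> \<le> ennreal ((25 * Cws + 1) ^ k) *
          (ennreal (25 * Cws) * emeasure \<mu> (hyperbolic_ball (x (Suc k)) r0))"
        using Suc.prems x by (intro mult_left_mono submean_measure_step[OF \<mu> assms(1)]) auto
      also have "\<dots> \<le> ennreal ((25 * Cws + 1) ^ k) *
          (ennreal (25 * Cws + 1) * emeasure \<mu> (hyperbolic_ball (x (Suc k)) r0))"
        by (intro mult_left_mono mult_right_mono ennreal_leI) auto
      also have "\<dots> = ennreal ((25 * Cws + 1) ^ Suc k) * emeasure \<mu> (hyperbolic_ball (x (Suc k)) r0)"
        using assms(2) by (simp add: ennreal_mult mult_ac)
      finally show ?case .
    qed (simp add: x)
    from this[of n] show "emeasure \<mu> (hyperbolic_ball z r0) \<le>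
        ennreal ((25 * Cws + 1) ^ n) * emeasure \<mu> (hyperbolic_ball w r0)"
      by (simp add: x)
  qed
qed

text \<open>Cover the large ball about the origin by finitely many balls of radius
  \<open>r0\<close>, carry the cover to \<open>z\<close> by an automorphism, and compare each ball
  with the one about \<open>z\<close>. The number of balls does not depend on
  \<open>z\<close>.\<close>

lemma submean_measure_large_ball:
  assumes "0 < r0" "0 \<le> Cws" "0 \<le> s" "s < 1"
  obtains A where "0 < A" "\<And>\<mu> z. submean_measure \<mu> r0 Cws \<Longrightarrow> z \<in> \<bbbD> \<Longrightarrow>
    emeasure \<mu> {w \<in> \<bbbD>. pseudo_dist z w \<le> s} \<le> ennreal A * emeasure \<mu> (hyperbolic_ball z r0)"
proof -
  have R: "0 < tanh (r0 / 2)"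
    using assms by simp
  obtain F where F: "finite F" "F \<subseteq> \<bbbD>" "cball 0 s \<subseteq> (\<Union>a\<in>F. {w \<in> \<bbbD>. pseudo_dist a w < tanh (r0 / 2)})"
    using finite_pseudo_ball_cover[OF assms(3,4) R] .
  define t where "t = Max (insert 0 (cmod ` F))"
  have t: "t < 1" "\<And>a. a \<in> F \<Longrightarrow> cmod a \<le> t"
    using F by (auto simp: t_def)
  obtain A where A: "0 < A" "\<And>\<mu> z w. submean_measure \<mu> r0 Cws \<Longrightarrow> z \<in> \<bbbD> \<Longrightarrow> w \<in> \<bbbD> \<Longrightarrow> pseudo_dist z w \<le> t \<Longrightarrow>
    emeasure \<mu> (hyperbolic_ball z r0) \<le> ennreal A * emeasure \<mu> (hyperbolic_ball w r0)"
    using submean_measure_balls_comparable[OF assms(1,2) t(1)] by blast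
  show thesis
  proof
    show "0 < (real (card F) + 1) * A"
      using A(1) by simp
    fix \<mu> z assume \<mu>: "submean_measure \<mu> r0 Cws" and z: "z \<in> \<bbbD>"
    have bm: "borel_measure_on_disk \<mu>"
      using \<mu> by (simp add: submean_measure_def)
    have z': "- z \<in> \<bbbD>"
      using z by simp
    \<comment> \<open>The transported centres. By invariance they are as far from \<open>z\<close>
      as the original ones are from the origin, hence within \<open>t\<close>.\<close>
    define y where "y a = disk_shift (- z) a" for a
    have yD: "y a \<in> \<bbbD>" if "a \<in> F" for a
      unfolding y_def using that F z' by (intro disk_shift_in_disk) auto
    have yz: "pseudo_dist (y a) z \<le> t" if "a \<in> F" for a
    proof -
      have "z = disk_shift (- z) 0"
        by simp
      then have "pseudo_dist (y a) z = pseudo_dist a 0"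
        unfolding y_def using pseudo_dist_disk_shift[OF z', of a 0] that F by auto
      then show ?thesis
        using t(2)[OF that] by simp
    qed
    have sub: "{w \<in> \<bbbD>. pseudo_dist z w \<le> s} \<subseteq> (\<Union>a\<in>F. hyperbolic_ball (y a) r0)"
    proof
      fix w assume "w \<in> {w \<in> \<bbbD>. pseudo_dist z w \<le> s}"
      then have w: "w \<in> \<bbbD>" "pseudo_dist z w \<le> s"
        by auto
      then have "disk_shift z w \<in> cball 0 s"
        by simp
      then obtain a where a: "a \<in> F" "pseudo_dist a (disk_shift z w) < tanh (r0 / 2)"
        using F(3) by blast
      have "pseudo_dist (y a) w = pseudo_dist a (disk_shift z w)"
        using pseudo_dist_disk_shift[OF z', of a "disk_shift z w"] disk_shift_inverse[OF z w(1)]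
          disk_shift_in_disk[OF z w(1)] a F(2) unfolding y_def by auto
      then have "w \<in> hyperbolic_ball (y a) r0"
        using a w hyperbolic_ball_eq[OF yD[OF a(1)]] by simp
      then show "w \<in> (\<Union>a\<in>F. hyperbolic_ball (y a) r0)"
        using a(1) by blast
    qed
    have sets: "hyperbolic_ball (y a) r0 \<in> sets \<mu>" if "a \<in> F" for a
      using sets_hyperbolic_ball[OF bm yD[OF that]] .
    have "emeasure \<mu> {w \<in> \<bbbD>. pseudo_dist z w \<le> s} \<le> emeasure \<mu> (\<Union>a\<in>F. hyperbolic_ball (y a) r0)"
      using F sets sub by (intro emeasure_mono sets.finite_UN) auto
    also have "\<dots> \<le> (\<Sum>a\<in>F. emeasure \<mu> (hyperbolic_ball (y a) r0))"
      using F sets by (intro emeasure_subadditive_finite) auto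
    also have "\<dots> \<le> (\<Sum>a\<in>F. ennreal A * emeasure \<mu> (hyperbolic_ball z r0))"
      using A(2)[OF \<mu> yD z yz] by (intro sum_mono) auto
    also have "\<dots> = ennreal (real (card F) * A) * emeasure \<mu> (hyperbolic_ball z r0)"
      using A(1) by (simp add: ennreal_mult mult.assoc ennreal_of_nat_eq_real_of_nat)
    also have "\<dots> \<le> ennreal ((real (card F) + 1) * A) * emeasure \<mu> (hyperbolic_ball z r0)"
      using A(1) by (intro mult_right_mono ennreal_leI) auto
    finally show "emeasure \<mu> {w \<in> \<bbbD>. pseudo_dist z w \<le> s} \<le>
        ennreal ((real (card F) + 1) * A) * emeasure \<mu> (hyperbolic_ball z r0)" .
  qed
qed

section \<open>The comparison\<close>

text \<open>One countable index type for all boxes. For \<open>m \<ge> 2 ^ j\<close> the angle would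
  wrap around the circle and repeat a box, so these indices get the empty set.\<close>

definition indexed_box :: "nat \<times> nat \<Rightarrow> complex set" where
  "indexed_box i = (if snd i < 2 ^ fst i then dyadic_box (fst i) (snd i) else {})"

lemma indexed_box_subset: "indexed_box i \<subseteq> \<bbbD>"
  by (auto simp: indexed_box_def dyadic_box_def)

lemma indexed_box_cover: "z \<in> \<bbbD> \<Longrightarrow> \<exists>i. z \<in> indexed_box i"
  using dyadic_box_cover by (metis fst_conv indexed_box_def snd_conv)

lemma disjoint_indexed_box: "disjoint_family_on indexed_box J"
proof -
  have "i = i'" if "z \<in> indexed_box i" "z \<in> indexed_box i'" for z i i'
    using that dyadic_box_disjoint[of "snd i" "fst i" "snd i'" "fst i'" z]
    by (auto simp: indexed_box_def prod_eq_iff split: if_splits)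
  then show ?thesis
    unfolding disjoint_family_on_def by blast
qed

lemma sets_indexed_box: "borel_measure_on_disk \<mu> \<Longrightarrow> indexed_box i \<in> sets \<mu>"
  by (rule borel_measure_on_disk_sets[OF _ _ indexed_box_subset])
    (auto simp: indexed_box_def borel_dyadic_box)

lemma pseudo_dist_indexed_box:
  "z \<in> indexed_box i \<Longrightarrow> w \<in> indexed_box i \<Longrightarrow> pseudo_dist z w \<le> box_diameter"
  by (auto simp: indexed_box_def intro: pseudo_dist_dyadic_box split: if_splits)

text \<open>The boxes cover the disk. The series is written as an integral over
  \<open>count_space\<close>, so that its exchange with the integral over the disk is
  available.\<close>

lemma nn_integral_le_sum_boxes:
  assumes "borel_measure_on_disk \<nu>" "h \<in> borel_measurable \<nu>"
  shows "(\<integral>\<^sup>+z. h z \<partial>\<nu>) \<le> (\<integral>\<^sup>+i. (\<integral>\<^sup>+z. h z * indicator (indexed_box i) z \<partial>\<nu>) \<partial>count_space UNIV)"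
proof -
  have "(\<integral>\<^sup>+z. h z \<partial>\<nu>) \<le> (\<integral>\<^sup>+z. (\<integral>\<^sup>+i. h z * indicator (indexed_box i) z \<partial>count_space UNIV) \<partial>\<nu>)"
  proof (rule nn_integral_mono)
    fix z assume "z \<in> space \<nu>"
    then have "z \<in> \<bbbD>"
      using borel_measure_on_disk_space[OF assms(1)] by simp
    then obtain i where "z \<in> indexed_box i"
      using indexed_box_cover by blast
    then have "h z = h z * indicator (indexed_box i) z"
      by simp
    also have "\<dots> \<le> (\<integral>\<^sup>+i. h z * indicator (indexed_box i) z \<partial>count_space UNIV)"
      by (rule nn_integral_ge_point) simp
    finally show "h z \<le> (\<integral>\<^sup>+i. h z * indicator (indexed_box i) z \<partial>count_space UNIV)" .
  qed
  also have "\<dots> = (\<integral>\<^sup>+i. (\<integral>\<^sup>+z. h z * indicator (indexed_box i) z \<partial>\<nu>) \<partial>count_space UNIV)"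
    using assms(2) sets_indexed_box[OF assms(1)]
    by (intro nn_integral_count_space_nn_integral) auto
  finally show ?thesis .
qed

lemma sum_boxes_le:
  assumes "borel_measure_on_disk \<mu>" "\<And>i. i \<in> J \<Longrightarrow> indexed_box i \<subseteq> S" "S \<in> sets \<mu>"
  shows "(\<integral>\<^sup>+i. emeasure \<mu> (indexed_box i) * indicator J i \<partial>count_space UNIV) \<le> emeasure \<mu> S"
proof -
  have "(\<integral>\<^sup>+i. emeasure \<mu> (indexed_box i) * indicator J i \<partial>count_space UNIV) =
      (\<integral>\<^sup>+i. emeasure \<mu> (indexed_box i) \<partial>count_space J)"
    by (simp add: nn_integral_count_space_indicator)
  also have "\<dots> = emeasure \<mu> (\<Union>i\<in>J. indexed_box i)"
    using sets_indexed_box[OF assms(1)] disjoint_indexed_box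
    by (intro emeasure_UN_countable[symmetric]) auto
  also have "\<dots> \<le> emeasure \<mu> S"
    using assms(2,3) by (intro emeasure_mono) auto
  finally show ?thesis .
qed

text \<open>Summing the local estimates and exchanging sum and integral, the factor in front of \<open>g z\<close>
  is a sum of \<open>\<mu>\<close> over disjoint boxes near \<open>z\<close>, divided by the measure of the ball about \<open>z\<close>;
  so no count of the boxes near \<open>z\<close> is needed.\<close>

lemma submean_measure_comparison:
  assumes "0 < r0" "0 \<le> C" "0 \<le> Cws"
  obtains K where "0 < K" "\<And>\<mu> \<nu> g. submean_measure \<mu> r0 Cws \<Longrightarrow> borel_measure_on_disk \<nu> \<Longrightarrow>
      (\<And>j m. m < 2 ^ j \<Longrightarrow> emeasure \<nu> (dyadic_box j m) \<le> ennreal C * emeasure \<mu> (dyadic_box j m)) \<Longrightarrow>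
      subharmonic_on g \<bbbD> \<Longrightarrow> continuous_on \<bbbD> g \<Longrightarrow> (\<And>z. z \<in> \<bbbD> \<Longrightarrow> 0 \<le> g z) \<Longrightarrow>
      (\<integral>\<^sup>+z. ennreal (g z) \<partial>\<nu>) \<le> ennreal K * (\<integral>\<^sup>+z. ennreal (g z) \<partial>\<mu>)"
proof -
  define R where "R = tanh (r0 / 2)"
  have R: "0 < R" "R < 1"
    using assms(1) by (auto simp: R_def tanh_real_lt_1)
  \<comment> \<open>\<open>s\<close> bounds the distance from a point of a box to any point of a
    ball of radius \<open>r0\<close> centred in that box; \<open>s'\<close> allows for one more box
    diameter.\<close>
  define s where "s = triangle_bound box_diameter R"
  have s: "0 \<le> s" "s < 1"
    unfolding s_def using triangle_bound box_diameter R by auto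
  define s' where "s' = triangle_bound s box_diameter"
  have s': "0 \<le> s'" "s' < 1"
    unfolding s'_def using triangle_bound box_diameter s by auto
  obtain A where A: "0 < A" "\<And>\<mu> z w. submean_measure \<mu> r0 Cws \<Longrightarrow> z \<in> \<bbbD> \<Longrightarrow> w \<in> \<bbbD> \<Longrightarrow> pseudo_dist z w \<le> s \<Longrightarrow>
    emeasure \<mu> (hyperbolic_ball z r0) \<le> ennreal A * emeasure \<mu> (hyperbolic_ball w r0)"
    using submean_measure_balls_comparable[OF assms(1,3) s(2)] by blast
  obtain A0 where A0: "0 < A0" "\<And>\<mu> z w. submean_measure \<mu> r0 Cws \<Longrightarrow> z \<in> \<bbbD> \<Longrightarrow> w \<in> \<bbbD> \<Longrightarrow> pseudo_dist z w \<le> box_diameter \<Longrightarrow>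
    emeasure \<mu> (hyperbolic_ball z r0) \<le> ennreal A0 * emeasure \<mu> (hyperbolic_ball w r0)"
    using submean_measure_balls_comparable[OF assms(1,3) box_diameter(2)] by blast
  obtain B where B: "0 < B" "\<And>\<mu> z. submean_measure \<mu> r0 Cws \<Longrightarrow> z \<in> \<bbbD> \<Longrightarrow>
    emeasure \<mu> {w \<in> \<bbbD>. pseudo_dist z w \<le> s'} \<le> ennreal B * emeasure \<mu> (hyperbolic_ball z r0)"
    using submean_measure_large_ball[OF assms(1,3) s'] by blast
  \<comment> \<open>\<open>C\<close> comes from the box hypothesis and \<open>Cws\<close> from the
    sub-mean inequality. \<open>A0\<close> pays for moving the ball within a box to the
    representative \<open>a i\<close>, and \<open>A\<close> for moving it from \<open>a i\<close> to
    \<open>z\<close>.\<close>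
  define L where "L = C * Cws * A0 * A"
  have L: "0 \<le> L"
    using assms A A0 by (simp add: L_def)
  show thesis
  proof
    show "0 < L * B + 1"
      using L B by (simp add: add_nonneg_pos)
    fix \<mu> \<nu> :: "complex measure" and g :: "complex \<Rightarrow> real"
    assume \<mu>: "submean_measure \<mu> r0 Cws" and \<nu>: "borel_measure_on_disk \<nu>"
      and box: "\<And>j m. m < 2 ^ j \<Longrightarrow> emeasure \<nu> (dyadic_box j m) \<le> ennreal C * emeasure \<mu> (dyadic_box j m)"
      and g: "subharmonic_on g \<bbbD>" "continuous_on \<bbbD> g" "\<And>z. z \<in> \<bbbD> \<Longrightarrow> 0 \<le> g z"
    have \<mu>': "borel_measure_on_disk \<mu>"
      using \<mu> by (simp add: submean_measure_def)
    have gm: "(\<lambda>z. ennreal (g z)) \<in> borel_measurable \<mu>" "(\<lambda>z. ennreal (g z)) \<in> borel_measurable \<nu>"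
      using borel_measure_on_disk_measurable[OF _ g(2)] \<mu>' \<nu> by auto
    define M where "M z = measure \<mu> (hyperbolic_ball z r0)" for z
    have M: "emeasure \<mu> (hyperbolic_ball z r0) = ennreal (M z)" "0 < M z" if "z \<in> \<bbbD>" for z
    proof -
      have "emeasure \<mu> (hyperbolic_ball z r0) < \<infinity>"
        using \<mu> that unfolding submean_measure_def by blast
      then show *: "emeasure \<mu> (hyperbolic_ball z r0) = ennreal (M z)"
        unfolding M_def by (intro emeasure_eq_ennreal_measure) auto
      show "0 < M z"
        using submean_measure_ball_pos[OF \<mu> assms(1) that] unfolding * by simp
    qed
    have MA: "M z \<le> A * M w" if "z \<in> \<bbbD>" "w \<in> \<bbbD>" "pseudo_dist z w \<le> s" for z w
      using A(2)[OF \<mu> that] A(1) M[OF that(1)] M[OF that(2)] by (simp add: ennreal_mult'[symmetric])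
    have MA0: "M z \<le> A0 * M w" if "z \<in> \<bbbD>" "w \<in> \<bbbD>" "pseudo_dist z w \<le> box_diameter" for z w
      using A0(2)[OF \<mu> that] A0(1) M[OF that(1)] M[OF that(2)] by (simp add: ennreal_mult'[symmetric])
    define a where "a i = (SOME z. z \<in> indexed_box i)" for i
    have a: "a i \<in> indexed_box i" "a i \<in> \<bbbD>" if "indexed_box i \<noteq> {}" for i
    proof -
      show "a i \<in> indexed_box i"
        unfolding a_def using that by (auto intro: someI)
      then show "a i \<in> \<bbbD>"
        using indexed_box_subset by blast
    qed
    \<comment> \<open>A single set containing all balls of radius \<open>r0\<close> centred in box
      \<open>i\<close>; it is empty for an empty box, where \<open>a i\<close> is arbitrary.\<close>
    define E where "E i = {z \<in> \<bbbD>. pseudo_dist (a i) z \<le> s \<and> indexed_box i \<noteq> {}}" for i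
    have setsE: "E i \<in> sets \<mu>" for i
    proof (cases "indexed_box i = {}")
      case False
      have "(\<lambda>z. pseudo_dist (a i) z) \<in> borel_measurable \<mu>"
        using a[OF False] \<mu>' continuous_on_disk_shift
        by (intro borel_measure_on_disk_measurable continuous_on_norm) blast+
      then have "{z \<in> space \<mu>. pseudo_dist (a i) z \<le> s} \<in> sets \<mu>"
        by measurable
      then show ?thesis
        using False borel_measure_on_disk_space[OF \<mu>'] by (simp add: E_def)
    qed (simp add: E_def)
    define c where "c i = ennreal (C * (Cws * A0 / M (a i))) * emeasure \<mu> (indexed_box i)" for i
    have local: "(\<integral>\<^sup>+z. ennreal (g z) * indicator (indexed_box i) z \<partial>\<nu>) \<le>
        (\<integral>\<^sup>+z. c i * (ennreal (g z) * indicator (E i) z) \<partial>\<mu>)" for i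
    proof (cases "indexed_box i = {}")
      case False
      have ai: "a i \<in> indexed_box i" "a i \<in> \<bbbD>" and i: "snd i < 2 ^ fst i"
        using a[OF False] False by (auto simp: indexed_box_def split: if_splits)
      define I where "I = (\<integral>\<^sup>+z. ennreal (g z) * indicator (E i) z \<partial>\<mu>)"
      \<comment> \<open>A bound for \<open>g\<close> on the whole box that no longer involves
        \<open>w\<close>, ready to be multiplied by the \<open>\<nu>\<close>-measure of the
        box.\<close>
      have sup: "ennreal (g w) \<le> ennreal (Cws * A0 / M (a i)) * I" if w: "w \<in> indexed_box i" for w
      proof -
        have wD: "w \<in> \<bbbD>"
          using w indexed_box_subset by blast
        have "z \<in> E i" if "z \<in> hyperbolic_ball w r0" for z
        proof -
          have "z \<in> \<bbbD>" "pseudo_dist w z \<le> R"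
            using that hyperbolic_ball_eq[OF wD] by (auto simp: R_def)
          then have "pseudo_dist (a i) z \<le> s"
            unfolding s_def using ai wD pseudo_dist_indexed_box[OF ai(1) w] box_diameter R
            by (intro pseudo_dist_triangle)
          then show ?thesis
            using \<open>z \<in> \<bbbD>\<close> False by (simp add: E_def)
        qed
        then have "(\<integral>\<^sup>+z\<in>hyperbolic_ball w r0. ennreal (g z) \<partial>\<mu>) \<le> I"
          unfolding I_def by (intro nn_integral_mono mult_left_mono) (auto simp: indicator_def)
        then have "ennreal (g w) * ennreal (M w) \<le> ennreal Cws * I"
          using submean_measure_apply[OF \<mu> assms(1) g(1) g(3) g(2) wD] M(1)[OF wD]
          by (metis (no_types, lifting) mult_left_mono order_trans zero_le)
        then have "ennreal (1 / M w) * (ennreal (g w) * ennreal (M w)) \<le> ennreal (1 / M w) * (ennreal Cws * I)"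
          by (rule mult_left_mono) simp
        also have "ennreal (1 / M w) * (ennreal (g w) * ennreal (M w)) = ennreal (g w)"
          using M(2)[OF wD] g(3)[OF wD] by (simp add: ennreal_mult'[symmetric])
        also have "ennreal (1 / M w) * (ennreal Cws * I) = ennreal (Cws / M w) * I"
          using M(2)[OF wD] assms(3) by (simp add: ennreal_mult'[symmetric] mult.assoc[symmetric])
        also have "\<dots> \<le> ennreal (Cws * A0 / M (a i)) * I"
        proof (intro mult_right_mono ennreal_leI)
          have "M (a i) \<le> A0 * M w"
            using pseudo_dist_indexed_box[OF ai(1) w] by (rule MA0[OF ai(2) wD])
          then have "Cws * M (a i) \<le> Cws * (A0 * M w)"
            using assms(3) by (rule mult_left_mono)
          then show "Cws / M w \<le> Cws * A0 / M (a i)"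
            using M(2)[OF wD] M(2)[OF ai(2)] by (simp add: field_simps)
        qed simp
        finally show ?thesis .
      qed
      have "(\<integral>\<^sup>+z. ennreal (g z) * indicator (indexed_box i) z \<partial>\<nu>) \<le>
          (\<integral>\<^sup>+z. (ennreal (Cws * A0 / M (a i)) * I) * indicator (indexed_box i) z \<partial>\<nu>)"
        using sup by (intro nn_integral_mono) (simp add: indicator_def)
      also have "\<dots> = (ennreal (Cws * A0 / M (a i)) * I) * emeasure \<nu> (indexed_box i)"
        using sets_indexed_box[OF \<nu>] by (simp add: nn_integral_cmult_indicator)
      also have "\<dots> \<le> (ennreal (Cws * A0 / M (a i)) * I) * (ennreal C * emeasure \<mu> (indexed_box i))"
        using box[OF i] i by (intro mult_left_mono) (auto simp: indexed_box_def)
      also have "\<dots> = c i * I"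
      proof -
        have "ennreal (C * (Cws * A0 / M (a i))) = ennreal C * ennreal (Cws * A0 / M (a i))"
          using assms(2) by (rule ennreal_mult')
        then show ?thesis
          unfolding c_def by (simp only: mult_ac)
      qed
      also have "\<dots> = (\<integral>\<^sup>+z. c i * (ennreal (g z) * indicator (E i) z) \<partial>\<mu>)"
        unfolding I_def using setsE gm(1)
        by (intro nn_integral_cmult[symmetric] borel_measurable_times_ennreal borel_measurable_indicator)
      finally show ?thesis .
    qed simp
    have factor: "(\<integral>\<^sup>+i. c i * indicator (E i) z \<partial>count_space UNIV) \<le> ennreal (L * B)" if z: "z \<in> \<bbbD>" for z
    proof -
      define J where "J = {i. z \<in> E i}"
      have term_le: "c i * indicator (E i) z \<le> ennreal (L / M z) * (emeasure \<mu> (indexed_box i) * indicator J i)" for i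
      proof (cases "z \<in> E i")
        case True
        then have ai: "a i \<in> \<bbbD>" "pseudo_dist (a i) z \<le> s"
          using a by (auto simp: E_def)
        \<comment> \<open>Replaces the ball about \<open>a i\<close> by the one about
          \<open>z\<close>, so that the factor \<open>L / M z\<close> can be taken out of the sum
          over \<open>i\<close>.\<close>
        have "M z \<le> A * M (a i)"
          using MA[OF z ai(1)] ai(2) pseudo_dist_commute by metis
        then have "C * Cws * A0 * M z \<le> C * Cws * A0 * (A * M (a i))"
          using assms A0 by (intro mult_left_mono) auto
        then have "C * (Cws * A0 / M (a i)) \<le> L / M z"
          using M(2)[OF z] M(2)[OF ai(1)] by (simp add: L_def field_simps)
        then show ?thesis
          using True by (simp add: c_def J_def mult_right_mono ennreal_leI)
      qed simp
      have "(\<integral>\<^sup>+i. c i * indicator (E i) z \<partial>count_space UNIV) \<le>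
          (\<integral>\<^sup>+i. ennreal (L / M z) * (emeasure \<mu> (indexed_box i) * indicator J i) \<partial>count_space UNIV)"
        by (intro nn_integral_mono term_le)
      also have "\<dots> = ennreal (L / M z) * (\<integral>\<^sup>+i. emeasure \<mu> (indexed_box i) * indicator J i \<partial>count_space UNIV)"
        by (intro nn_integral_cmult) simp
      \<comment> \<open>The boxes with index in \<open>J\<close> are disjoint and lie within
        \<open>s'\<close> of \<open>z\<close>, so their measures add up to at most that of one
        larger ball.\<close>
      also have "\<dots> \<le> ennreal (L / M z) * emeasure \<mu> {w \<in> \<bbbD>. pseudo_dist z w \<le> s'}"
      proof (intro mult_left_mono sum_boxes_le \<mu>')
        have "(\<lambda>w. pseudo_dist z w) \<in> borel_measurable \<mu>"
          using z \<mu>' continuous_on_disk_shift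
          by (intro borel_measure_on_disk_measurable continuous_on_norm) blast+
        then have "{w \<in> space \<mu>. pseudo_dist z w \<le> s'} \<in> sets \<mu>"
          by measurable
        then show "{w \<in> \<bbbD>. pseudo_dist z w \<le> s'} \<in> sets \<mu>"
          using borel_measure_on_disk_space[OF \<mu>'] by simp
        show "indexed_box i \<subseteq> {w \<in> \<bbbD>. pseudo_dist z w \<le> s'}" if "i \<in> J" for i
        proof
          fix w assume w: "w \<in> indexed_box i"
          then have wD: "w \<in> \<bbbD>" and ai: "a i \<in> indexed_box i" "a i \<in> \<bbbD>" "pseudo_dist z (a i) \<le> s"
            using a[of i] indexed_box_subset[of i] that pseudo_dist_commute[of z "a i"]
            by (auto simp: J_def E_def)
          have "pseudo_dist z w \<le> s'"
            unfolding s'_def using z ai wD s box_diameter pseudo_dist_indexed_box[OF ai(1) w]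
            by (intro pseudo_dist_triangle)
          then show "w \<in> {w \<in> \<bbbD>. pseudo_dist z w \<le> s'}"
            using wD by simp
        qed
      qed simp
      also have "\<dots> \<le> ennreal (L / M z) * (ennreal B * ennreal (M z))"
        using B(2)[OF \<mu> z] M(1)[OF z] by (intro mult_left_mono) auto
      also have "\<dots> = ennreal (L * B)"
        using L B(1) M(2)[OF z] by (simp add: ennreal_mult'[symmetric])
      finally show ?thesis .
    qed
    have "(\<integral>\<^sup>+z. ennreal (g z) \<partial>\<nu>) \<le>
        (\<integral>\<^sup>+i. (\<integral>\<^sup>+z. ennreal (g z) * indicator (indexed_box i) z \<partial>\<nu>) \<partial>count_space UNIV)"
      by (intro nn_integral_le_sum_boxes \<nu> gm)
    also have "\<dots> \<le> (\<integral>\<^sup>+i. (\<integral>\<^sup>+z. c i * (ennreal (g z) * indicator (E i) z) \<partial>\<mu>) \<partial>count_space UNIV)"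
      by (intro nn_integral_mono local)
    also have "\<dots> = (\<integral>\<^sup>+z. (\<integral>\<^sup>+i. c i * (ennreal (g z) * indicator (E i) z) \<partial>count_space UNIV) \<partial>\<mu>)"
      using setsE gm(1)
      by (intro nn_integral_count_space_nn_integral[symmetric] borel_measurable_times_ennreal
          borel_measurable_const borel_measurable_indicator) auto
    also have "\<dots> = (\<integral>\<^sup>+z. ennreal (g z) * (\<integral>\<^sup>+i. c i * indicator (E i) z \<partial>count_space UNIV) \<partial>\<mu>)"
      by (subst nn_integral_cmult[symmetric]) (auto simp: mult_ac)
    also have "\<dots> \<le> (\<integral>\<^sup>+z. ennreal (L * B + 1) * ennreal (g z) \<partial>\<mu>)"
    proof (rule nn_integral_mono)
      fix z assume "z \<in> space \<mu>"
      then have "z \<in> \<bbbD>"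
        using borel_measure_on_disk_space[OF \<mu>'] by simp
      then have "(\<integral>\<^sup>+i. c i * indicator (E i) z \<partial>count_space UNIV) \<le> ennreal (L * B + 1)"
        by (rule order_trans[OF factor]) (simp add: ennreal_leI)
      then show "ennreal (g z) * (\<integral>\<^sup>+i. c i * indicator (E i) z \<partial>count_space UNIV) \<le> ennreal (L * B + 1) * ennreal (g z)"
        by (subst mult.commute) (rule mult_right_mono, auto)
    qed
    also have "\<dots> = ennreal (L * B + 1) * (\<integral>\<^sup>+z. ennreal (g z) \<partial>\<mu>)"
      by (intro nn_integral_cmult gm)
    finally show "(\<integral>\<^sup>+z. ennreal (g z) \<partial>\<nu>) \<le> ennreal (L * B + 1) * (\<integral>\<^sup>+z. ennreal (g z) \<partial>\<mu>)" .
  qed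
qed

text \<open>For large \<open>\<kappa>\<close> the ball about \<open>w\<close> of radius
  \<open>\<kappa> * r0\<close> contains the one about \<open>z\<close>. Its measure is then
  infinite, and a finite doubling constant passes this on to the ball of radius
  \<open>r0\<close>.\<close>

lemma locally_doubling_infinite:
  assumes "locally_doubling \<mu> r0" "borel_measure_on_disk \<mu>" "0 < r0" "z \<in> \<bbbD>" "w \<in> \<bbbD>"
    and inf: "emeasure \<mu> (hyperbolic_ball z r0) = \<infinity>"
  shows "emeasure \<mu> (hyperbolic_ball w r0) = \<infinity>"
proof -
  define R where "R = tanh (r0 / 2)"
  have R: "0 < R" "R < 1"
    using assms(3) by (auto simp: R_def tanh_real_lt_1)
  define t where "t = triangle_bound (pseudo_dist w z) R"
  have wz: "0 \<le> pseudo_dist w z" "pseudo_dist w z < 1"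
    using disk_shift_in_disk[OF assms(5,4)] by auto
  have t: "0 \<le> t" "t < 1"
    unfolding t_def using triangle_bound[OF wz] R by auto
  \<comment> \<open>Doubling requires \<open>\<kappa> \<ge> 1\<close>; the summand 1 makes
    \<open>t < tanh (\<kappa> * r0 / 2)\<close> strict.\<close>
  define \<kappa> where "\<kappa> = max 1 (2 * artanh t / r0 + 1)"
  have "2 * artanh t / r0 < \<kappa>"
    by (simp add: \<kappa>_def)
  then have "artanh t < \<kappa> * r0 / 2"
    using assms(3) by (simp add: field_simps)
  then have tk: "t < tanh (\<kappa> * r0 / 2)"
    using artanh_less_iff[OF t] by blast
  have "hyperbolic_ball z r0 \<subseteq> hyperbolic_ball w (\<kappa> * r0)"
  proof
    fix x assume "x \<in> hyperbolic_ball z r0"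
    then have x: "x \<in> \<bbbD>" "pseudo_dist z x \<le> R"
      using hyperbolic_ball_eq[OF assms(4)] by (auto simp: R_def)
    have "pseudo_dist w x \<le> t"
      unfolding t_def using assms(4,5) x wz R by (intro pseudo_dist_triangle) auto
    then show "x \<in> hyperbolic_ball w (\<kappa> * r0)"
      using hyperbolic_ball_eq[OF assms(5)] tk x(1) by simp
  qed
  then have "\<infinity> \<le> emeasure \<mu> (hyperbolic_ball w (\<kappa> * r0))"
    unfolding inf[symmetric] by (rule emeasure_mono) (rule sets_hyperbolic_ball[OF assms(2,5)])
  moreover obtain D where "emeasure \<mu> (hyperbolic_ball w (\<kappa> * r0)) \<le> ennreal D * emeasure \<mu> (hyperbolic_ball w r0)"
    using assms(1,5) unfolding locally_doubling_def by (metis \<kappa>_def max.cobounded1)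
  ultimately have "ennreal D * emeasure \<mu> (hyperbolic_ball w r0) = \<infinity>"
    by (simp add: top_unique)
  then show ?thesis
    by (auto simp: ennreal_mult_eq_top_iff)
qed

lemma nn_integral_not_locally_integrable:
  assumes "borel_measure_on_disk \<mu>" "g \<in> borel_measurable \<mu>" "\<And>z. 0 \<le> g z" "\<not> locally_integrable_on_disk \<mu> g"
  shows "(\<integral>\<^sup>+z. ennreal (g z) \<partial>\<mu>) = \<infinity>"
proof (rule ccontr)
  assume "(\<integral>\<^sup>+z. ennreal (g z) \<partial>\<mu>) \<noteq> \<infinity>"
  then have "integrable \<mu> g"
    using assms(2,3) by (intro integrableI_nonneg) (auto simp: less_top)
  then have "set_integrable \<mu> K g" if "compact K" "K \<subseteq> \<bbbD>" for K
    unfolding set_integrable_def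
    using borel_measure_on_disk_sets[OF assms(1) borel_closed[OF compact_imp_closed[OF that(1)]] that(2)]
    by (intro integrable_mult_indicator)
  then show False
    using assms(4) unfolding locally_integrable_on_disk_def by blast
qed

theorem theorem1p19:
  fixes r0 C Cws :: real
  assumes "0 < r0" and "0 \<le> C" and "0 \<le> Cws"
  shows "\<exists>K>0. \<forall>(\<mu> :: complex measure) (\<nu> :: complex measure) (\<omega> :: complex \<Rightarrow> real) (p :: real) (f :: complex \<Rightarrow> complex).
     borel_measure_on_disk \<mu> \<longrightarrow> borel_measure_on_disk \<nu> \<longrightarrow> disk_weight \<omega> \<longrightarrow>
     weighted_submean \<mu> r0 Cws \<longrightarrow> locally_doubling \<mu> r0 \<longrightarrow>
     (\<forall>j m. m < 2 ^ j \<longrightarrow> emeasure \<nu> (dyadic_box j m) \<le> ennreal C * emeasure \<mu> (dyadic_box j m)) \<longrightarrow>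
     0 < p \<longrightarrow> f \<in> weighted_bergman_space p \<omega> \<longrightarrow>
     (\<integral>\<^sup>+z. ennreal (cmod (f z) powr p) \<partial>\<nu>) \<le> ennreal K * (\<integral>\<^sup>+z. ennreal (cmod (f z) powr p) \<partial>\<mu>)"
proof -
  obtain K where K: "0 < K" "\<And>\<mu> \<nu> g. submean_measure \<mu> r0 Cws \<Longrightarrow> borel_measure_on_disk \<nu> \<Longrightarrow>
      (\<And>j m. m < 2 ^ j \<Longrightarrow> emeasure \<nu> (dyadic_box j m) \<le> ennreal C * emeasure \<mu> (dyadic_box j m)) \<Longrightarrow>
      subharmonic_on g \<bbbD> \<Longrightarrow> continuous_on \<bbbD> g \<Longrightarrow> (\<And>z. z \<in> \<bbbD> \<Longrightarrow> 0 \<le> g z) \<Longrightarrow>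
      (\<integral>\<^sup>+z. ennreal (g z) \<partial>\<nu>) \<le> ennreal K * (\<integral>\<^sup>+z. ennreal (g z) \<partial>\<mu>)"
    using submean_measure_comparison[OF assms] by blast
  show ?thesis
  proof (intro exI[of _ K] conjI allI impI)
    show "0 < K"
      by (rule K)
    fix \<mu> \<nu> :: "complex measure" and \<omega> :: "complex \<Rightarrow> real" and p :: real and f :: "complex \<Rightarrow> complex"
    assume \<mu>: "borel_measure_on_disk \<mu>" and \<nu>: "borel_measure_on_disk \<nu>"
      and submean: "weighted_submean \<mu> r0 Cws" and doubling: "locally_doubling \<mu> r0"
      and box: "\<forall>j m. m < 2 ^ j \<longrightarrow> emeasure \<nu> (dyadic_box j m) \<le> ennreal C * emeasure \<mu> (dyadic_box j m)"
      and p: "0 < p" and f: "f \<in> weighted_bergman_space p \<omega>"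
    define g where "g z = cmod (f z) powr p" for z
    have hol: "f holomorphic_on \<bbbD>"
      using f by (simp add: weighted_bergman_space_def)
    have sub: "subharmonic_on g \<bbbD>"
      unfolding g_def using hol p by (intro subharmonic_on_cmod_powr) auto
    have cont: "continuous_on \<bbbD> g"
      unfolding g_def using holomorphic_on_imp_continuous_on[OF hol] p
      by (intro continuous_on_powr' continuous_intros) auto
    have nonneg: "0 \<le> g z" for z
      by (simp add: g_def)
    have "(\<integral>\<^sup>+z. ennreal (g z) \<partial>\<nu>) \<le> ennreal K * (\<integral>\<^sup>+z. ennreal (g z) \<partial>\<mu>)"
    proof (cases "\<exists>z\<in>\<bbbD>. emeasure \<mu> (hyperbolic_ball z r0) = \<infinity>")
      case False
      then have "submean_measure \<mu> r0 Cws"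
        using \<mu> submean by (auto simp: submean_measure_def less_top)
      then show ?thesis
        using box by (intro K(2) \<nu> sub cont nonneg) auto
    next
      case True
      then have inf: "emeasure \<mu> (hyperbolic_ball w r0) = \<infinity>" if "w \<in> \<bbbD>" for w
        using locally_doubling_infinite[OF doubling \<mu> assms(1) _ that] by blast
      show ?thesis
      proof (cases "locally_integrable_on_disk \<mu> g")
        case True
        \<comment> \<open>Every ball has infinite measure, so the quotient in the sub-mean property
          is 0, and its product with the integral is 0 even if the integral is infinite.\<close>
        have "ennreal (g w) = 0" if "w \<in> \<bbbD>" for w
        proof -
          have "ennreal (g w) \<le> ennreal Cws / emeasure \<mu> (hyperbolic_ball w r0) *
              (\<integral>\<^sup>+z\<in>hyperbolic_ball w r0. ennreal (g z) \<partial>\<mu>)"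
            using submean sub nonneg True that unfolding weighted_submean_def by blast
          then show ?thesis
            by (simp add: inf[OF that])
        qed
        then have "(\<integral>\<^sup>+z. ennreal (g z) \<partial>\<nu>) = (\<integral>\<^sup>+z. 0 \<partial>\<nu>)"
          using borel_measure_on_disk_space[OF \<nu>] by (intro nn_integral_cong) simp
        then show ?thesis
          by simp
      next
        case False
        \<comment> \<open>The sub-mean property says nothing about such \<open>g\<close>, but the
          right-hand side is infinite because \<open>K > 0\<close>.\<close>
        then have "(\<integral>\<^sup>+z. ennreal (g z) \<partial>\<mu>) = \<infinity>"
          by (intro nn_integral_not_locally_integrable \<mu> nonneg borel_measure_on_disk_measurable[OF \<mu> cont])
        then show ?thesis
          using K(1) by (simp add: ennreal_mult_top)
      qed
    qed
    then show "(\<integral>\<^sup>+z. ennreal (cmod (f z) powr p) \<partial>\<nu>) \<le> ennreal K * (\<integral>\<^sup>+z. ennreal (cmod (f z) powr p) \<partial>\<mu>)"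
      by (simp only: g_def)
  qed
qed

end
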